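(* The space $\mathrm{CO}(A)$ of (left-invariant) circular orders on an infinite Abelian group $A$ has no isolated points. In particular, when $A$ is countably infinite, $\mathrm{CO}(A)$ is homeomorphic to a Cantor set.
   Context: A circular order on a set $S$ is a function $c:S^3\to\{1,-1,0\}$ such that (i) $c(a_1,a_2,a_3)=0$ if and only if $a_i=a_j$ for some $i\neq j$, and (ii) $c(a_2,a_3,a_4)-c(a_1,a_3,a_4)+c(a_1,a_2,a_4)-c(a_1,a_2,a_3)=0$ for all $a_1,a_2,a_3,a_4\in S$. A (left-invariant) circular order on a group $G$ is a circular order $c$ on the set $G$ with $c(ga_1,ga_2,ga_3)=c(a_1,a_2,a_3)$ for all $g,a_1,a_2,a_3\in G$. $\mathrm{CO}(G)$ is the set of all such orders on $G$, with the subspace topology from the function space $\{1,-1,0\}^{G\times G\times G}$; a neighborhood basis of $c\in\mathrm{CO}(G)$ is given by the sets of those $c'\in\mathrm{CO}(G)$ with $c'(s_1,s_2,s_3)=c(s_1,s_2,s_3)$ for all $s_1,s_2,s_3\in S$, as $S$ ranges over the finite subsets of $G$.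
   Formalization: The second sentence is stated for countably infinite A with CO(A) nonempty; without this it fails, e.g. for the direct sum of countably many copies of Z/2, which has no circular order, so CO(A) is empty. *)

theory Defs
  imports "HOL-Analysis.Analysis" "HOL-Algebra.Group"
begin

text \<open>Functions on \<open>S\<^sup>3\<close> are represented extensionally (value \<open>undefined\<close> outside
  \<open>S \<times> S \<times> S\<close>), so that a circular order on \<open>S\<close> is determined by its values on \<open>S\<close> and the
  orders form a subset of the carrier of the product topology below.\<close>

definition circular_order_on :: "'a set \<Rightarrow> ('a \<times> 'a \<times> 'a \<Rightarrow> int) \<Rightarrow> bool" where
  "circular_order_on S c \<longleftrightarrow>
     c \<in> (S \<times> S \<times> S) \<rightarrow>\<^sub>E {1, -1, 0} \<and>
     (\<forall>a1\<in>S. \<forall>a2\<in>S. \<forall>a3\<in>S.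
        c (a1, a2, a3) = 0 \<longleftrightarrow> a1 = a2 \<or> a1 = a3 \<or> a2 = a3) \<and>
     (\<forall>a1\<in>S. \<forall>a2\<in>S. \<forall>a3\<in>S. \<forall>a4\<in>S.
        c (a2, a3, a4) - c (a1, a3, a4) + c (a1, a2, a4) - c (a1, a2, a3) = 0)"

definition CO :: "('a, 'b) monoid_scheme \<Rightarrow> ('a \<times> 'a \<times> 'a \<Rightarrow> int) set" where
  "CO G = {c. circular_order_on (carrier G) c \<and>
     (\<forall>g\<in>carrier G. \<forall>a1\<in>carrier G. \<forall>a2\<in>carrier G. \<forall>a3\<in>carrier G.
        c (g \<otimes>\<^bsub>G\<^esub> a1, g \<otimes>\<^bsub>G\<^esub> a2, g \<otimes>\<^bsub>G\<^esub> a3) = c (a1, a2, a3))}"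

definition CO_topology :: "('a, 'b) monoid_scheme \<Rightarrow> ('a \<times> 'a \<times> 'a \<Rightarrow> int) topology" where
  "CO_topology G =
     subtopology
       (product_topology (\<lambda>_. discrete_topology {1, -1, 0}) (carrier G \<times> carrier G \<times> carrier G))
       (CO G)"

lemma topspace_CO_topology: "topspace (CO_topology G) = CO G"
  by (auto simp: CO_topology_def CO_def circular_order_on_def)

definition isolated_point :: "'a topology \<Rightarrow> 'a \<Rightarrow> bool" where
  "isolated_point X x \<longleftrightarrow> x \<in> topspace X \<and> openin X {x}"

text \<open>The middle-thirds Cantor set.\<close>

primrec cantor_stage :: "nat \<Rightarrow> real set" where
  "cantor_stage 0 = {0..1}"
| "cantor_stage (Suc n) = (\<lambda>x. x / 3) ` cantor_stage n \<union> (\<lambda>x. 2 / 3 + x / 3) ` cantor_stage n"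

definition cantor_set :: "real set" where
  "cantor_set = (\<Inter>n. cantor_stage n)"

end

theory Submission
  imports Defs "HOL-Algebra.Multiplicative_Group" "HOL-Number_Theory.Cong"
begin

text \<open>Let \<open>c\<close> be an invariant circular order on an infinite abelian group \<open>A\<close>. Cutting the circle at the
identity turns \<open>c\<close> into the carry \<open>f\<close> of an addition: \<open>f a b\<close> is \<open>1\<close> if passing from \<open>1\<close> to \<open>a\<close> and
then on to \<open>a b\<close> reaches or passes the starting point again, and \<open>0\<close> otherwise. Circular orders correspond to normalized
\<open>{0,1}\<close>-valued 2-cocycles of this kind (lemmas \<open>order_of_carry_of_order\<close> and
\<open>order_of_carry_in_CO\<close>), and the cocycle \<open>f\<close> defines a central extension \<open>E\<close> of \<open>A\<close> by the integers
in which the pairs \<open>(k, a)\<close> with \<open>k \<ge> 0\<close> other than the identity form the positive cone of a total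
group order. So a circular order on \<open>A\<close> is a totally ordered abelian group \<open>E\<close> with a cofinal
positive element \<open>z = (1, 1)\<close>.

Every neighbourhood of \<open>c\<close> contains all orders that agree with \<open>c\<close> on some finite set. Two constructions give
such an order different from \<open>c\<close>.

\<^item> If \<open>A\<close> has an element of infinite order, then \<open>E\<close> has rank at least two. Agreement on a finite
  set follows once finitely many elements of the positive cone of \<open>E\<close> stay positive. Such elements have
  no nontrivial relation with nonnegative coefficients, so by Gordan's alternative some homomorphism \<open>h\<close> from \<open>E\<close> to the rationals is positive on all of them and on \<open>z\<close>
  (\<open>exists_additive_positive\<close>). Ordering \<open>E\<close> lexicographically, first by \<open>h\<close> and then on the
  nontrivial kernel of \<open>h\<close> either by the old order or by its reverse, gives two orders with the
  prescribed signs. They induce different circular orders, hence one of them is not \<open>c\<close>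
  (\<open>exists_nearby_carry\<close>).

\<^item> If \<open>A\<close> is a torsion group, it has only finitely many elements of each exponent, as in the group of
  roots of unity (\<open>finite_torsion\<close>). Given a finite set of exponent dividing \<open>N\<close>, some element has
  order a prime power \<open>p ^ (k + 1)\<close> not dividing \<open>N\<close>. The injective endomorphism that is
  \<open>x \<mapsto> x ^ (1 + p ^ k)\<close> on the \<open>p\<close>-part and the identity on the prime-to-\<open>p\<close> part fixes the finite set and
  moves that element. It cannot preserve \<open>c\<close>, because an order preserving bijection of a finite
  linear order is the identity; so pulling \<open>c\<close> back along it gives a new order
  (\<open>exists_nearby_order_torsion\<close>).

For countable \<open>A\<close> the space of circular orders is compact, being closed in a product of finite
discrete spaces, and its countably many coordinates provide clopen sets that separate points. Brouwer's
characterization (\<open>Cantor_space_characterization\<close>) identifies such a space without isolated points with the space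
of binary sequences, and ternary digits do the same for the middle-thirds set.\<close>

section \<open>Homomorphisms from abelian groups to the rationals\<close>

definition additive_on :: "('g, 'm) monoid_scheme \<Rightarrow> ('g \<Rightarrow> rat) \<Rightarrow> bool" where
  "additive_on G h \<longleftrightarrow> (\<forall>x\<in>carrier G. \<forall>y\<in>carrier G. h (x \<otimes>\<^bsub>G\<^esub> y) = h x + h y)"

lemma (in group) additive_on_one: "additive_on G h \<Longrightarrow> h \<one> = 0"
  unfolding additive_on_def by (metis add_cancel_right_right one_closed r_one)

lemma (in group) additive_on_inv:
  assumes "additive_on G h" "x \<in> carrier G" shows "h (inv x) = - h x"
proof -
  have "h (x \<otimes> inv x) = h x + h (inv x)"
    using assms unfolding additive_on_def by blast
  then show ?thesis
    using additive_on_one[OF assms(1)] r_inv[OF assms(2)] by (simp only:)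
qed

lemma (in group) additive_on_pow:
  assumes "additive_on G h" "x \<in> carrier G" shows "h (x [^] (n::nat)) = of_nat n * h x"
proof (induction n)
  case 0
  show ?case using assms additive_on_one by simp
next
  case (Suc n)
  then show ?case using assms by (auto simp: additive_on_def algebra_simps)
qed

text \<open>A homomorphism from a subgroup to the rationals, encoded by its graph \<open>R\<close>: the last clause makes \<open>R\<close> single
valued. For graphs, extension is inclusion, which suits Zorn's lemma.\<close>

definition partial_hom :: "('g, 'm) monoid_scheme \<Rightarrow> ('g \<times> rat) set \<Rightarrow> bool" where
  "partial_hom G R \<longleftrightarrow> R \<subseteq> carrier G \<times> UNIV \<and> (\<one>\<^bsub>G\<^esub>, 0) \<in> R \<and>
     (\<forall>x p y q. (x, p) \<in> R \<longrightarrow> (y, q) \<in> R \<longrightarrow> (x \<otimes>\<^bsub>G\<^esub> y, p + q) \<in> R) \<and>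
     (\<forall>x p. (x, p) \<in> R \<longrightarrow> (inv\<^bsub>G\<^esub> x, - p) \<in> R) \<and>
     (\<forall>p. (\<one>\<^bsub>G\<^esub>, p) \<in> R \<longrightarrow> p = 0)"

lemma partial_homI:
  assumes "R \<subseteq> carrier G \<times> UNIV" "(\<one>\<^bsub>G\<^esub>, 0) \<in> R"
    and "\<And>x p y q. (x, p) \<in> R \<Longrightarrow> (y, q) \<in> R \<Longrightarrow> (x \<otimes>\<^bsub>G\<^esub> y, p + q) \<in> R"
    and "\<And>x p. (x, p) \<in> R \<Longrightarrow> (inv\<^bsub>G\<^esub> x, - p) \<in> R"
    and "\<And>p. (\<one>\<^bsub>G\<^esub>, p) \<in> R \<Longrightarrow> p = 0"
  shows "partial_hom G R"
  unfolding partial_hom_def using assms by blast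

lemma (in group) partial_hom_int_pow:
  assumes R: "partial_hom G R" and xp: "(x, p) \<in> R"
  shows "(x [^] (m::int), of_int m * p) \<in> R"
proof -
  have nat: "(x [^] (n::nat), of_nat n * p) \<in> R" for n
  proof (induction n)
    case 0
    show ?case using R by (simp add: partial_hom_def)
  next
    case (Suc n)
    then have "(x [^] n \<otimes> x, of_nat n * p + p) \<in> R"
      using R xp unfolding partial_hom_def by blast
    then show ?case by (simp add: algebra_simps)
  qed
  have x: "x \<in> carrier G" using R xp by (auto simp: partial_hom_def)
  show ?thesis
  proof (cases m rule: int_cases2)
    case (nonneg n)
    then show ?thesis using nat[of n] by (simp add: int_pow_int)
  next
    case (nonpos n)
    have "(inv (x [^] n), - (of_nat n * p)) \<in> R"
      using nat[of n] R unfolding partial_hom_def by blast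
    then show ?thesis using nonpos x by (simp add: int_pow_neg_int)
  qed
qed

lemma (in group) partial_hom_unique:
  assumes R: "partial_hom G R" and "(x, p) \<in> R" "(x, q) \<in> R" shows "p = q"
proof -
  have "x \<in> carrier G" using R assms(2) by (auto simp: partial_hom_def)
  moreover have "(x \<otimes> inv x, p + - q) \<in> R" using assms unfolding partial_hom_def by blast
  ultimately have "(\<one>, p - q) \<in> R" by simp
  then show ?thesis using R by (auto simp: partial_hom_def)
qed

text \<open>The value at \<open>g\<close> is forced as soon as some nonzero power of \<open>g\<close> lies in the domain, and exists then
because rationals can be divided; otherwise any value will do, for instance \<open>0\<close>.\<close>

lemma (in comm_group) partial_hom_extend:
  assumes R: "partial_hom G R" and g: "g \<in> carrier G"
  shows "\<exists>S x. partial_hom G S \<and> R \<subseteq> S \<and> (g, x) \<in> S"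
proof -
  have "\<exists>x. \<forall>m::int. \<forall>w. (g [^] m, w) \<in> R \<longrightarrow> w = of_int m * x"
  proof (cases "\<exists>m::int. \<exists>w. m \<noteq> 0 \<and> (g [^] m, w) \<in> R")
    case True
    then obtain m :: int and w where m: "m \<noteq> 0" "(g [^] m, w) \<in> R" by blast
    show ?thesis
    proof (intro exI allI impI)
      fix m' :: int and w' assume w': "(g [^] m', w') \<in> R"
      have "(g [^] (m * m'), of_int m' * w) \<in> R"
        using partial_hom_int_pow[OF R m(2), of m'] g by (simp add: int_pow_pow)
      moreover have "(g [^] (m * m'), of_int m * w') \<in> R"
        using partial_hom_int_pow[OF R w', of m] g by (simp add: int_pow_pow mult.commute)
      ultimately have "of_int m' * w = of_int m * w'"
        by (rule partial_hom_unique[OF R])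
      then show "w' = of_int m' * (w / of_int m)"
        using m(1) by (simp add: field_simps)
    qed
  next
    case False
    have "w = of_int m * 0" if "(g [^] m, w) \<in> R" for m :: int and w
      using False that R by (cases "m = 0") (auto simp: partial_hom_def)
    then show ?thesis by blast
  qed
  then obtain x where x: "\<And>m::int. \<And>w. (g [^] m, w) \<in> R \<Longrightarrow> w = of_int m * x" by blast
  define S where "S = {(y \<otimes> g [^] m, q + of_int m * x) | y q (m::int). (y, q) \<in> R}"
  have RC: "y \<in> carrier G" if "(y, q) \<in> R" for y q using R that by (auto simp: partial_hom_def)
  have S_I: "(y \<otimes> g [^] m, q + of_int m * x) \<in> S" if "(y, q) \<in> R" for y q and m :: int
    using that by (auto simp: S_def)
  have one: "(\<one>, 0) \<in> R" using R by (auto simp: partial_hom_def)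
  have RS: "R \<subseteq> S"
  proof
    fix t assume t: "t \<in> R"
    obtain y q where "t = (y, q)" by fastforce
    then show "t \<in> S" using S_I[of y q 0] t RC by simp
  qed
  have "(a \<otimes> b, p + q) \<in> S" if ab: "(a, p) \<in> S" "(b, q) \<in> S" for a p b q
  proof -
    obtain y r and m :: int where 1: "a = y \<otimes> g [^] m" "p = r + of_int m * x" "(y, r) \<in> R"
      using ab(1) by (auto simp: S_def)
    obtain y' r' and m' :: int where 2: "b = y' \<otimes> g [^] m'" "q = r' + of_int m' * x" "(y', r') \<in> R"
      using ab(2) by (auto simp: S_def)
    have "(y \<otimes> y', r + r') \<in> R" using R 1(3) 2(3) unfolding partial_hom_def by blast
    from S_I[OF this, of "m + m'"]
    have "((y \<otimes> y') \<otimes> (g [^] m \<otimes> g [^] m'), (r + r') + of_int (m + m') * x) \<in> S"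
      using g by (simp add: int_pow_mult)
    moreover have "(y \<otimes> y') \<otimes> (g [^] m \<otimes> g [^] m') = a \<otimes> b"
      using 1 2 RC g by (simp add: m_ac)
    moreover have "(r + r') + of_int (m + m') * x = p + q" using 1 2 by (simp add: algebra_simps)
    ultimately show ?thesis by simp
  qed
  moreover have "(inv a, - p) \<in> S" if a: "(a, p) \<in> S" for a p
  proof -
    obtain y r and m :: int where 1: "a = y \<otimes> g [^] m" "p = r + of_int m * x" "(y, r) \<in> R"
      using a by (auto simp: S_def)
    have "(inv y, - r) \<in> R" using R 1(3) unfolding partial_hom_def by blast
    from S_I[OF this, of "- m"] show ?thesis
      using 1 g RC by (simp add: int_pow_neg inv_mult)
  qed
  moreover have "p = 0" if a: "(\<one>, p) \<in> S" for p
  proof -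
    obtain y r and m :: int where 1: "\<one> = y \<otimes> g [^] m" "p = r + of_int m * x" "(y, r) \<in> R"
      using a by (auto simp: S_def)
    have "y = g [^] (- m)" using 1 RC g by (metis int_pow_closed int_pow_neg inv_equality inv_inv)
    then show ?thesis using x[of "- m" r] 1 by simp
  qed
  moreover have "S \<subseteq> carrier G \<times> UNIV" using RC g by (auto simp: S_def)
  moreover have "(\<one>, 0) \<in> S" using one RS by blast
  ultimately have "partial_hom G S" by (intro partial_homI)
  moreover have "(g, x) \<in> S" using S_I[OF one, of 1] g by simp
  ultimately show ?thesis using RS by blast
qed

text \<open>The homomorphism sending \<open>v\<close> to \<open>1\<close> on the infinite cyclic group of its powers has a maximal extension, and by
\<open>partial_hom_extend\<close> that one is defined everywhere.\<close>

lemma (in comm_group) exists_additive_eq_one: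
  assumes v: "v \<in> carrier G" and tf: "\<And>n::nat. n > 0 \<Longrightarrow> v [^] n \<noteq> \<one>"
  shows "\<exists>h. additive_on G h \<and> h v = 1"
proof -
  define R0 where "R0 = {(v [^] m, of_int m :: rat) | m::int. True}"
  have "(a \<otimes> b, p + q) \<in> R0" if ab: "(a, p) \<in> R0" "(b, q) \<in> R0" for a p b q
  proof -
    obtain i j :: int where "a = v [^] i" "p = of_int i" "b = v [^] j" "q = of_int j"
      using ab unfolding R0_def by blast
    then have "a \<otimes> b = v [^] (i + j)" "p + q = of_int (i + j)" using v by (simp_all add: int_pow_mult)
    then show ?thesis unfolding R0_def by blast
  qed
  moreover have "(inv a, - p) \<in> R0" if ab: "(a, p) \<in> R0" for a p
  proof -
    obtain i :: int where "a = v [^] i" "p = of_int i" using ab unfolding R0_def by blast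
    then have "inv a = v [^] (- i)" "- p = of_int (- i)" using v by (simp_all add: int_pow_neg)
    then show ?thesis unfolding R0_def by blast
  qed
  moreover have "p = 0" if one: "(\<one>, p) \<in> R0" for p
  proof -
    obtain m :: int where m: "v [^] m = \<one>" "p = of_int m" using one by (auto simp: R0_def)
    have "v [^] (nat \<bar>m\<bar>) = \<one>"
    proof (cases m rule: int_cases2)
      case (nonneg n)
      then show ?thesis using m(1) by (simp add: int_pow_int)
    next
      case (nonpos n)
      then have "inv (v [^] n) = \<one>" using m(1) v by (simp add: int_pow_neg_int)
      then show ?thesis using nonpos v by (metis abs_minus abs_of_nat inv_inv inv_one nat_int nat_pow_closed)
    qed
    then have "\<not> nat \<bar>m\<bar> > 0" using tf by blast
    then show ?thesis using m(2) by simp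
  qed
  moreover have "(\<one>, 0) \<in> R0" unfolding R0_def by (auto intro: exI[of _ 0])
  moreover have "R0 \<subseteq> carrier G \<times> UNIV" using v by (auto simp: R0_def)
  ultimately have R0: "partial_hom G R0" by (intro partial_homI)
  have "\<exists>M\<in>{R. partial_hom G R \<and> R0 \<subseteq> R}. \<forall>X\<in>{R. partial_hom G R \<and> R0 \<subseteq> R}. M \<subseteq> X \<longrightarrow> X = M"
  proof (rule subset_Zorn_nonempty)
    show "{R. partial_hom G R \<and> R0 \<subseteq> R} \<noteq> {}" using R0 by blast
    fix C assume C: "C \<noteq> {}" "subset.chain {R. partial_hom G R \<and> R0 \<subseteq> R} C"
    have ph: "partial_hom G R" if "R \<in> C" for R using C that by (auto simp: subset.chain_def)
    have "(a \<otimes> b, p + q) \<in> \<Union>C" if ab: "(a, p) \<in> \<Union>C" "(b, q) \<in> \<Union>C" for a p b q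
    proof -
      obtain X Y where XY: "X \<in> C" "Y \<in> C" "(a, p) \<in> X" "(b, q) \<in> Y" using ab by blast
      then have "X \<subseteq> Y \<or> Y \<subseteq> X" using C by (auto simp: subset_chain_def)
      then obtain Z where "Z \<in> C" "(a, p) \<in> Z" "(b, q) \<in> Z" using XY by blast
      then show ?thesis using ph[of Z] unfolding partial_hom_def by blast
    qed
    moreover have "\<Union>C \<subseteq> carrier G \<times> UNIV" "(\<one>, 0) \<in> \<Union>C"
      and "\<And>x p. (x, p) \<in> \<Union>C \<Longrightarrow> (inv x, - p) \<in> \<Union>C" "\<And>p. (\<one>, p) \<in> \<Union>C \<Longrightarrow> p = 0"
      using C(1) ph unfolding partial_hom_def by blast+
    ultimately have "partial_hom G (\<Union>C)" by (intro partial_homI)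
    moreover have "R0 \<subseteq> \<Union>C" using C by (fastforce simp: subset.chain_def)
    ultimately show "\<Union>C \<in> {R. partial_hom G R \<and> R0 \<subseteq> R}" by blast
  qed
  then obtain M where M: "partial_hom G M" "R0 \<subseteq> M"
    and max: "\<And>X. partial_hom G X \<Longrightarrow> M \<subseteq> X \<Longrightarrow> X = M" by (metis (mono_tags, lifting) mem_Collect_eq order_trans)
  define h where "h x = (THE p. (x, p) \<in> M)" for x
  have hM: "h x = p" if "(x, p) \<in> M" for x p
    unfolding h_def using that partial_hom_unique[OF M(1)] by blast
  have total: "(x, h x) \<in> M" if x: "x \<in> carrier G" for x
  proof -
    obtain p where "(x, p) \<in> M" using partial_hom_extend[OF M(1) x] max by blast
    then show ?thesis using hM by simp
  qed
  have "additive_on G h" unfolding additive_on_def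
  proof (intro ballI)
    fix x y assume "x \<in> carrier G" "y \<in> carrier G"
    then have "(x \<otimes> y, h x + h y) \<in> M" using M(1) total unfolding partial_hom_def by blast
    then show "h (x \<otimes> y) = h x + h y" by (rule hM)
  qed
  moreover have "(v, 1) \<in> R0" unfolding R0_def using v by (auto intro!: exI[of _ 1])
  ultimately show ?thesis using hM M(2) by blast
qed

text \<open>Turns a combination with rational coefficients into a positive multiple with natural coefficients, which makes
sense as a product of powers in a group.\<close>

lemma rat_clear_denominators:
  fixes p q :: rat
  assumes "p > 0" "q \<ge> 0"
  shows "\<exists>s>0. \<exists>i j. i > 0 \<and> of_nat i = s * p \<and> of_nat j = s * q"
proof -
  obtain a b where ab: "p = of_int a / of_int b" "b > 0"
    by (metis quotient_of_denom_pos quotient_of_div surj_pair)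
  obtain c d where cd: "q = of_int c / of_int d" "d > 0"
    by (metis quotient_of_denom_pos quotient_of_div surj_pair)
  have a: "a > 0" using assms ab by (simp add: zero_less_divide_iff)
  have c: "c \<ge> 0" using assms cd by (simp add: zero_le_divide_iff)
  have "of_nat (nat (a * d)) = of_int (b * d) * p" using ab cd a by simp
  moreover have "of_nat (nat (b * c)) = of_int (b * d) * q" using ab cd c by simp
  moreover have "nat (a * d) > 0" using a cd by simp
  moreover have "(of_int (b * d) :: rat) > 0" using ab cd by simp
  ultimately show ?thesis by blast
qed

lemma finite_bound_between:
  fixes u :: rat
  assumes "finite B" "\<And>b. b \<in> B \<Longrightarrow> b < u"
  shows "\<exists>t<u. \<forall>b\<in>B. b < t"
proof (cases "B = {}")
  case True
  then show ?thesis using lt_ex by auto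
next
  case False
  then obtain t where "Max B < t" "t < u" using assms dense by (metis Max_in)
  then show ?thesis using assms(1) by (metis Max_ge order_le_less_trans)
qed

text \<open>Gordan's alternative, by Fourier-Motzkin elimination. Let \<open>h1\<close> be positive on all of the elements except possibly
on \<open>v\<close>, where it is at most \<open>0\<close>. For each other element \<open>u\<close> some combination \<open>w u\<close> of \<open>v\<close> and \<open>u\<close> with
nonnegative coefficients lies in the kernel of \<open>h1\<close>; it still belongs to \<open>P\<close>, so induction provides \<open>h2\<close>
positive on all \<open>w u\<close>. These inequalities ensure that some multiple \<open>t\<close> of \<open>h1\<close> corrects \<open>h2\<close> to be positive
on \<open>v\<close> and on every \<open>u\<close>.\<close>

lemma (in comm_group) exists_additive_positive:
  assumes PC: "P \<subseteq> carrier G" and one: "\<one> \<notin> P"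
    and mult: "\<And>x y. x \<in> P \<Longrightarrow> y \<in> P \<Longrightarrow> x \<otimes> y \<in> P"
    and "finite T" "T \<subseteq> P"
  shows "\<exists>h. additive_on G h \<and> (\<forall>x\<in>T. h x > 0)"
proof -
  have pow: "x [^] (n::nat) \<in> P" if "x \<in> P" "n > 0" for x n
    using that(2)
  proof (induction n)
    case (Suc n)
    then show ?case using that mult PC by (cases "n = 0") auto
  qed simp
  have "\<exists>h. additive_on G h \<and> (\<forall>x\<in>set vs. h x > 0)" if "set vs \<subseteq> P" for vs
    using that
  proof (induction "length vs" arbitrary: vs)
    case 0
    then show ?case by (intro exI[of _ "\<lambda>_. 0"]) (auto simp: additive_on_def)
  next
    case (Suc n)
    then obtain v us where vs: "vs = v # us" by (metis length_Suc_conv)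
    have v: "v \<in> P" "v \<in> carrier G" using Suc.prems vs PC by auto
    have us: "set us \<subseteq> P" "n = length us" using Suc vs by auto
    obtain h1 where h1: "additive_on G h1" "\<And>u. u \<in> set us \<Longrightarrow> h1 u > 0"
      using Suc.hyps(1)[OF us(2,1)] by blast
    show ?case
    proof (cases "us = []")
      case True
      have "v [^] n \<noteq> \<one>" if "n > 0" for n :: nat using pow[OF v(1) that] one by metis
      then obtain h where "additive_on G h" "h v = 1" using exists_additive_eq_one[OF v(2)] by blast
      then show ?thesis using True vs by (intro exI[of _ h]) auto
    next
      case ne: False
      show ?thesis
      proof (cases "h1 v > 0")
        case True
        then show ?thesis using h1 vs by auto
      next
        case False
        have "\<exists>s>0. \<exists>i j. i > 0 \<and> of_nat i = s * h1 u \<and> of_nat j = s * - h1 v" if "u \<in> set us" for u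
          by (rule rat_clear_denominators) (use h1(2)[OF that] False in auto)
        then obtain s i j where sij: "\<And>u. u \<in> set us \<Longrightarrow> s u > 0 \<and> i u > (0::nat) \<and>
            of_nat (i u) = s u * h1 u \<and> of_nat (j u :: nat) = s u * - h1 v"
          by metis
        define w where "w u = v [^] i u \<otimes> u [^] j u" for u
        have wP: "w u \<in> P" if "u \<in> set us" for u
        proof (cases "j u = 0")
          case True
          then show ?thesis using pow[OF v(1), of "i u"] sij[OF that] PC by (auto simp: w_def)
        next
          case False
          have "u \<in> P" using us that by blast
          then show ?thesis using pow[OF v(1), of "i u"] sij[OF that] pow[of u "j u"] False mult
            by (auto simp: w_def)
        qed
        have "set (map w us) \<subseteq> P" "n = length (map w us)" using wP us by auto
        then obtain h2 where h2: "additive_on G h2" "\<And>u. u \<in> set us \<Longrightarrow> h2 (w u) > 0"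
          using Suc.hyps(1)[of "map w us"] by auto
        \<comment> \<open>The lower bounds \<open>- h2 u / h1 u\<close> for \<open>t\<close> lie below the upper bound \<open>h2 v / (- h1 v)\<close>.\<close>
        have key: "h1 u * h2 v - h1 v * h2 u > 0" if u: "u \<in> set us" for u
        proof -
          have uC: "u \<in> carrier G" using u us PC by blast
          have "h2 (w u) = of_nat (i u) * h2 v + of_nat (j u) * h2 u"
            using h2(1) v uC additive_on_pow[OF h2(1)] by (simp add: w_def additive_on_def)
          also have "\<dots> = s u * (h1 u * h2 v - h1 v * h2 u)"
            using sij[OF u] by (simp add: algebra_simps)
          finally show ?thesis using h2(2)[OF u] sij[OF u] by (simp add: zero_less_mult_iff)
        qed
        define B where "B = (\<lambda>u. - h2 u / h1 u) ` set us"
        have B: "finite B" by (simp add: B_def)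
        have "\<exists>t. (\<forall>b\<in>B. b < t) \<and> h2 v + t * h1 v > 0"
        proof (cases "h1 v = 0")
          case True
          obtain u where "u \<in> set us" using ne by (cases us) auto
          then have "h2 v > 0" using key[of u] h1(2)[of u] True by (simp add: zero_less_mult_iff)
          moreover obtain t where "\<forall>b\<in>B. b < t"
          proof
            show "\<forall>b\<in>B. b < Max B + 1"
            proof
              fix b assume "b \<in> B"
              then have "b \<le> Max B" using B by simp
              then show "b < Max B + 1" by linarith
            qed
          qed
          ultimately show ?thesis using True by auto
        next
          case False
          then have neg: "h1 v < 0" using \<open>\<not> h1 v > 0\<close> by simp
          have "b < h2 v / (- h1 v)" if b: "b \<in> B" for b
          proof -
            obtain u where u: "u \<in> set us" "b = - h2 u / h1 u" using b unfolding B_def by blast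
            have "- h2 u * (- h1 v) < h2 v * h1 u" using key[OF u(1)] by (simp add: mult.commute)
            then have "- h2 u < h2 v / (- h1 v) * h1 u"
              using neg by (simp only: times_divide_eq_left pos_less_divide_eq neg_0_less_iff_less)
            then show ?thesis
              using h1(2)[OF u(1)] u(2) by (simp only: pos_divide_less_eq)
          qed
          then obtain t where t: "t < h2 v / (- h1 v)" "\<forall>b\<in>B. b < t"
            using finite_bound_between[OF B] by metis
          then have "t * (- h1 v) < h2 v"
            using neg by (simp only: pos_less_divide_eq neg_0_less_iff_less)
          then have "h2 v + t * h1 v > 0" by simp
          then show ?thesis using t by blast
        qed
        then obtain t where t: "\<And>b. b \<in> B \<Longrightarrow> b < t" "h2 v + t * h1 v > 0" by blast
        have "h2 u + t * h1 u > 0" if "u \<in> set us" for u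
        proof -
          have "- h2 u / h1 u < t" using t(1) that unfolding B_def by blast
          then have "- h2 u < t * h1 u" using h1(2)[OF that] by (simp only: pos_divide_less_eq)
          then show ?thesis by simp
        qed
        moreover have "additive_on G (\<lambda>x. h2 x + t * h1 x)"
          using h1(1) h2(1) by (simp add: additive_on_def algebra_simps)
        ultimately show ?thesis using t(2) vs by (intro exI[of _ "\<lambda>x. h2 x + t * h1 x"]) auto
      qed
    qed
  qed
  then show ?thesis using \<open>finite T\<close> \<open>T \<subseteq> P\<close> by (metis finite_list)
qed

section \<open>Circular orders as carry cocycles\<close>

text \<open>The value \<open>1\<close> at \<open>(a, a\<inverse>)\<close> for \<open>a\<close> other than the identity expresses that returning to the starting point
counts as one full turn.\<close>

definition carry_cocycle :: "('a, 'b) monoid_scheme \<Rightarrow> ('a \<Rightarrow> 'a \<Rightarrow> int) \<Rightarrow> bool" where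
  "carry_cocycle G f \<longleftrightarrow>
     (\<forall>a\<in>carrier G. \<forall>b\<in>carrier G. f a b = 0 \<or> f a b = 1) \<and>
     (\<forall>a\<in>carrier G. f \<one>\<^bsub>G\<^esub> a = 0 \<and> f a \<one>\<^bsub>G\<^esub> = 0) \<and>
     (\<forall>a\<in>carrier G. a \<noteq> \<one>\<^bsub>G\<^esub> \<longrightarrow> f a (inv\<^bsub>G\<^esub> a) = 1) \<and>
     (\<forall>a\<in>carrier G. \<forall>b\<in>carrier G. \<forall>d\<in>carrier G.
        f a b + f (a \<otimes>\<^bsub>G\<^esub> b) d = f b d + f a (b \<otimes>\<^bsub>G\<^esub> d))"

definition nonid :: "('a, 'b) monoid_scheme \<Rightarrow> 'a \<Rightarrow> int" where
  "nonid G a = (if a = \<one>\<^bsub>G\<^esub> then 0 else 1)"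

text \<open>With \<open>a = x\<inverse>y\<close> and \<open>b = y\<inverse>z\<close>, the three points are in positive order if \<open>f a b = 0\<close> and in negative order if
\<open>f a b = 1\<close>. Without the coboundary of \<open>nonid\<close> the formula would read \<open>1 - 2 f a b\<close>; the coboundary takes the
constant \<open>1\<close> for distinct points and corrects the value to \<open>0\<close> when two points coincide.\<close>

definition order_of_carry ::
    "('a, 'b) monoid_scheme \<Rightarrow> ('a \<Rightarrow> 'a \<Rightarrow> int) \<Rightarrow> ('a \<times> 'a \<times> 'a \<Rightarrow> int)" where
  "order_of_carry G f = (\<lambda>(x, y, z)\<in>carrier G \<times> carrier G \<times> carrier G.
     nonid G (inv\<^bsub>G\<^esub> x \<otimes>\<^bsub>G\<^esub> y) + nonid G (inv\<^bsub>G\<^esub> y \<otimes>\<^bsub>G\<^esub> z) - nonid G (inv\<^bsub>G\<^esub> x \<otimes>\<^bsub>G\<^esub> z)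
     - 2 * f (inv\<^bsub>G\<^esub> x \<otimes>\<^bsub>G\<^esub> y) (inv\<^bsub>G\<^esub> y \<otimes>\<^bsub>G\<^esub> z))"

definition carry_of_order ::
    "('a, 'b) monoid_scheme \<Rightarrow> ('a \<times> 'a \<times> 'a \<Rightarrow> int) \<Rightarrow> ('a \<Rightarrow> 'a \<Rightarrow> int)" where
  "carry_of_order G c a b =
     (nonid G a + nonid G b - nonid G (a \<otimes>\<^bsub>G\<^esub> b) - c (\<one>\<^bsub>G\<^esub>, a, a \<otimes>\<^bsub>G\<^esub> b)) div 2"

lemma CO_D:
  assumes c: "c \<in> CO G"
  shows CO_values: "\<And>x y z. x \<in> carrier G \<Longrightarrow> y \<in> carrier G \<Longrightarrow> z \<in> carrier G \<Longrightarrow>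
      c (x, y, z) = 1 \<or> c (x, y, z) = -1 \<or> c (x, y, z) = 0"
    and CO_zero: "\<And>x y z. x \<in> carrier G \<Longrightarrow> y \<in> carrier G \<Longrightarrow> z \<in> carrier G \<Longrightarrow>
      c (x, y, z) = 0 \<longleftrightarrow> x = y \<or> x = z \<or> y = z"
    and CO_cocycle: "\<And>w x y z. w \<in> carrier G \<Longrightarrow> x \<in> carrier G \<Longrightarrow> y \<in> carrier G \<Longrightarrow> z \<in> carrier G \<Longrightarrow>
      c (x, y, z) - c (w, y, z) + c (w, x, z) - c (w, x, y) = 0"
    and CO_left: "\<And>g x y z. g \<in> carrier G \<Longrightarrow> x \<in> carrier G \<Longrightarrow> y \<in> carrier G \<Longrightarrow> z \<in> carrier G \<Longrightarrow>
      c (g \<otimes>\<^bsub>G\<^esub> x, g \<otimes>\<^bsub>G\<^esub> y, g \<otimes>\<^bsub>G\<^esub> z) = c (x, y, z)"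
    and CO_undefined: "\<And>t. t \<notin> carrier G \<times> carrier G \<times> carrier G \<Longrightarrow> c t = undefined"
proof -
  have c': "c \<in> (carrier G \<times> carrier G \<times> carrier G) \<rightarrow>\<^sub>E {1, -1, 0}"
    using c by (auto simp: CO_def circular_order_on_def)
  show "c (x, y, z) = 1 \<or> c (x, y, z) = -1 \<or> c (x, y, z) = 0"
    if "x \<in> carrier G" "y \<in> carrier G" "z \<in> carrier G" for x y z
    using PiE_mem[OF c', of "(x, y, z)"] that by auto
  show "c t = undefined" if "t \<notin> carrier G \<times> carrier G \<times> carrier G" for t
    using PiE_arb[OF c' that] .
qed (use c in \<open>auto simp: CO_def circular_order_on_def\<close>)

lemma CO_I:
  assumes "\<And>x y z. x \<in> carrier G \<Longrightarrow> y \<in> carrier G \<Longrightarrow> z \<in> carrier G \<Longrightarrow>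
      c (x, y, z) = 1 \<or> c (x, y, z) = -1 \<or> c (x, y, z) = 0"
    and "\<And>x y z. x \<in> carrier G \<Longrightarrow> y \<in> carrier G \<Longrightarrow> z \<in> carrier G \<Longrightarrow>
      c (x, y, z) = 0 \<longleftrightarrow> x = y \<or> x = z \<or> y = z"
    and "\<And>w x y z. w \<in> carrier G \<Longrightarrow> x \<in> carrier G \<Longrightarrow> y \<in> carrier G \<Longrightarrow> z \<in> carrier G \<Longrightarrow>
      c (x, y, z) - c (w, y, z) + c (w, x, z) - c (w, x, y) = 0"
    and "\<And>g x y z. g \<in> carrier G \<Longrightarrow> x \<in> carrier G \<Longrightarrow> y \<in> carrier G \<Longrightarrow> z \<in> carrier G \<Longrightarrow>
      c (g \<otimes>\<^bsub>G\<^esub> x, g \<otimes>\<^bsub>G\<^esub> y, g \<otimes>\<^bsub>G\<^esub> z) = c (x, y, z)"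
    and "\<And>t. t \<notin> carrier G \<times> carrier G \<times> carrier G \<Longrightarrow> c t = undefined"
  shows "c \<in> CO G"
proof -
  have "c \<in> (carrier G \<times> carrier G \<times> carrier G) \<rightarrow>\<^sub>E {1, -1, 0}"
  proof (rule PiE_I)
    fix t assume "t \<in> carrier G \<times> carrier G \<times> carrier G"
    then show "c t \<in> {1, -1, 0}" using assms(1) by (cases t) auto
  qed (use assms(5) in auto)
  then show ?thesis
    using assms(2,3,4) unfolding CO_def circular_order_on_def by simp
qed

lemma CO_ext:
  assumes "c \<in> CO G" "c' \<in> CO G"
    and "\<And>x y z. x \<in> carrier G \<Longrightarrow> y \<in> carrier G \<Longrightarrow> z \<in> carrier G \<Longrightarrow> c (x, y, z) = c' (x, y, z)"
  shows "c = c'"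
proof
  fix t show "c t = c' t"
    using assms(3) CO_undefined[OF assms(1), of t] CO_undefined[OF assms(2), of t]
    by (cases "t \<in> carrier G \<times> carrier G \<times> carrier G") auto
qed

lemma (in group) carry_of_order_eq:
  assumes c: "c \<in> CO G" and ab: "a \<in> carrier G" "b \<in> carrier G"
  shows "2 * carry_of_order G c a b = nonid G a + nonid G b - nonid G (a \<otimes> b) - c (\<one>, a, a \<otimes> b)"
    and "carry_of_order G c a b = 0 \<or> carry_of_order G c a b = 1"
proof -
  have v: "c (\<one>, a, a \<otimes> b) = 1 \<or> c (\<one>, a, a \<otimes> b) = -1 \<or> c (\<one>, a, a \<otimes> b) = 0"
    using CO_values[OF c, of \<one> a "a \<otimes> b"] ab by simp
  have z: "c (\<one>, a, a \<otimes> b) = 0 \<longleftrightarrow> a = \<one> \<or> a \<otimes> b = \<one> \<or> b = \<one>"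
    using CO_zero[OF c, of \<one> a "a \<otimes> b"] ab by (simp add: eq_commute[of \<one>])
  have "nonid G a + nonid G b - nonid G (a \<otimes> b) - c (\<one>, a, a \<otimes> b) \<in> {0, 2}"
    using v z ab inv_one by (cases "a = \<one>"; cases "b = \<one>"; cases "a \<otimes> b = \<one>") (auto simp: nonid_def)
  then show "2 * carry_of_order G c a b = nonid G a + nonid G b - nonid G (a \<otimes> b) - c (\<one>, a, a \<otimes> b)"
    "carry_of_order G c a b = 0 \<or> carry_of_order G c a b = 1"
    by (auto simp: carry_of_order_def)
qed

lemma (in group) carry_cocycle_carry_of_order:
  assumes c: "c \<in> CO G"
  shows "carry_cocycle G (carry_of_order G c)"
proof -
  have 1: "carry_of_order G c \<one> a = 0 \<and> carry_of_order G c a \<one> = 0" if a: "a \<in> carrier G" for a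
    using carry_of_order_eq(1)[OF c, of \<one> a] carry_of_order_eq(1)[OF c, of a \<one>] CO_zero[OF c, of \<one> \<one> a] CO_zero[OF c, of \<one> a a] a
    by (simp add: nonid_def)
  have 2: "carry_of_order G c a (inv a) = 1" if a: "a \<in> carrier G" "a \<noteq> \<one>" for a
  proof -
    have "inv a \<noteq> \<one>" using a by (metis inv_inv inv_one)
    then show ?thesis
      using carry_of_order_eq(1)[OF c, of a "inv a"] CO_zero[OF c, of \<one> a \<one>] a by (simp add: nonid_def)
  qed
  have 3: "carry_of_order G c a b + carry_of_order G c (a \<otimes> b) d =
      carry_of_order G c b d + carry_of_order G c a (b \<otimes> d)"
    if "a \<in> carrier G" "b \<in> carrier G" "d \<in> carrier G" for a b d
  proof -
    have "c (a, a \<otimes> b, a \<otimes> (b \<otimes> d)) = c (\<one>, b, b \<otimes> d)"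
      using CO_left[OF c, of a \<one> b "b \<otimes> d"] that by simp
    then show ?thesis
      using carry_of_order_eq(1)[OF c, of a b] carry_of_order_eq(1)[OF c, of "a \<otimes> b" d]
        carry_of_order_eq(1)[OF c, of b d] carry_of_order_eq(1)[OF c, of a "b \<otimes> d"]
        CO_cocycle[OF c, of \<one> a "a \<otimes> b" "a \<otimes> (b \<otimes> d)"] that
      by (simp add: m_assoc)
  qed
  show ?thesis
    unfolding carry_cocycle_def using 1 2 3 carry_of_order_eq(2)[OF c] by blast
qed

lemma (in group) carry_cocycle_D:
  assumes f: "carry_cocycle G f"
  shows carry_values: "\<And>a b. a \<in> carrier G \<Longrightarrow> b \<in> carrier G \<Longrightarrow> f a b = 0 \<or> f a b = 1"
    and carry_one: "\<And>a. a \<in> carrier G \<Longrightarrow> f \<one> a = 0" "\<And>a. a \<in> carrier G \<Longrightarrow> f a \<one> = 0"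
    and carry_inv: "\<And>a. a \<in> carrier G \<Longrightarrow> a \<noteq> \<one> \<Longrightarrow> f a (inv a) = 1"
    and carry_assoc: "\<And>a b d. a \<in> carrier G \<Longrightarrow> b \<in> carrier G \<Longrightarrow> d \<in> carrier G \<Longrightarrow>
        f a b + f (a \<otimes> b) d = f b d + f a (b \<otimes> d)"
  using f unfolding carry_cocycle_def by blast+

lemma (in group) order_of_carry_apply:
  assumes "x \<in> carrier G" "y \<in> carrier G" "z \<in> carrier G"
  shows "order_of_carry G f (x, y, z) = nonid G (inv x \<otimes> y) + nonid G (inv y \<otimes> z)
     - nonid G (inv x \<otimes> z) - 2 * f (inv x \<otimes> y) (inv y \<otimes> z)"
  using assms by (simp add: order_of_carry_def)

lemma (in group) inv_mult_inv_mult: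
  assumes "x \<in> carrier G" "y \<in> carrier G" "z \<in> carrier G"
  shows "(inv x \<otimes> y) \<otimes> (inv y \<otimes> z) = inv x \<otimes> z"
  using assms by (metis inv_closed inv_solve_left m_assoc m_closed)

lemma (in group) order_of_carry_of_order:
  assumes c: "c \<in> CO G"
  shows "order_of_carry G (carry_of_order G c) = c"
proof
  fix t
  show "order_of_carry G (carry_of_order G c) t = c t"
  proof (cases "t \<in> carrier G \<times> carrier G \<times> carrier G")
    case True
    then obtain x y z where t: "t = (x, y, z)" "x \<in> carrier G" "y \<in> carrier G" "z \<in> carrier G"
      by (cases t) auto
    have "c (\<one>, inv x \<otimes> y, inv x \<otimes> z) = c (x, y, z)"
      using CO_left[OF c, of "inv x" x y z] t by simp
    then show ?thesis
      using carry_of_order_eq(1)[OF c, of "inv x \<otimes> y" "inv y \<otimes> z"] inv_mult_inv_mult[of x y z] t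
      by (simp add: order_of_carry_apply)
  next
    case False
    then show ?thesis using CO_undefined[OF c False] by (simp add: order_of_carry_def restrict_def)
  qed
qed

lemma (in group) order_of_carry_in_CO:
  assumes f: "carry_cocycle G f"
  shows "order_of_carry G f \<in> CO G"
proof -
  have eq_iff: "inv x \<otimes> y = \<one> \<longleftrightarrow> x = y" if "x \<in> carrier G" "y \<in> carrier G" for x y
    using that by (metis inv_equality inv_inv inv_closed l_inv)
  have self_inv: "inv y \<otimes> x = inv (inv x \<otimes> y)" if "x \<in> carrier G" "y \<in> carrier G" for x y
    using that by (simp add: inv_mult_group)
  have vals: "(order_of_carry G f (x, y, z) = 1 \<or> order_of_carry G f (x, y, z) = -1 \<or> order_of_carry G f (x, y, z) = 0)
      \<and> (order_of_carry G f (x, y, z) = 0 \<longleftrightarrow> x = y \<or> x = z \<or> y = z)"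
    if xyz: "x \<in> carrier G" "y \<in> carrier G" "z \<in> carrier G" for x y z
  proof -
    have v: "f (inv x \<otimes> y) (inv y \<otimes> z) = 0 \<or> f (inv x \<otimes> y) (inv y \<otimes> z) = 1"
      using carry_values[OF f] xyz by simp
    have 1: "f (inv x \<otimes> y) (inv y \<otimes> z) = 0" if "x = y \<or> y = z"
      using that carry_one[OF f] xyz by auto
    have 2: "f (inv x \<otimes> y) (inv y \<otimes> z) = 1" if "x = z" "x \<noteq> y"
      using that carry_inv[OF f, of "inv x \<otimes> y"] self_inv[of x y] eq_iff[of x y] xyz by auto
    show ?thesis
      using v 1 2 by (elim disjE) (auto simp: order_of_carry_apply xyz nonid_def eq_iff)
  qed
  show ?thesis
  proof (rule CO_I)
    fix w x y z
    assume wxyz: "w \<in> carrier G" "x \<in> carrier G" "y \<in> carrier G" "z \<in> carrier G"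
    have "f (inv w \<otimes> x) (inv x \<otimes> y) + f (inv w \<otimes> y) (inv y \<otimes> z)
        = f (inv x \<otimes> y) (inv y \<otimes> z) + f (inv w \<otimes> x) (inv x \<otimes> z)"
      using carry_assoc[OF f, of "inv w \<otimes> x" "inv x \<otimes> y" "inv y \<otimes> z"] wxyz
      by (simp add: inv_mult_inv_mult)
    then show "order_of_carry G f (x, y, z) - order_of_carry G f (w, y, z)
        + order_of_carry G f (w, x, z) - order_of_carry G f (w, x, y) = 0"
      by (simp add: order_of_carry_apply wxyz)
  next
    fix g x y z
    assume gxyz: "g \<in> carrier G" "x \<in> carrier G" "y \<in> carrier G" "z \<in> carrier G"
    have "inv (g \<otimes> u) \<otimes> (g \<otimes> v) = inv u \<otimes> v" if "u \<in> carrier G" "v \<in> carrier G" for u v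
      using that gxyz(1) inv_mult_inv_mult[of u "inv g" v] by (simp add: inv_mult_group)
    then show "order_of_carry G f (g \<otimes> x, g \<otimes> y, g \<otimes> z) = order_of_carry G f (x, y, z)"
      by (simp add: order_of_carry_apply gxyz)
  qed (use vals in \<open>auto simp: order_of_carry_def restrict_def\<close>)
qed

lemma (in group) order_of_carry_cancel:
  assumes "order_of_carry G f = order_of_carry G f'" "a \<in> carrier G" "b \<in> carrier G"
  shows "f a b = f' a b"
proof -
  have "inv a \<otimes> (a \<otimes> b) = b" using assms by (metis inv_closed l_inv l_one m_assoc)
  then show ?thesis
    using arg_cong[OF assms(1), of "\<lambda>h. h (\<one>, a, a \<otimes> b)"] assms(2,3)
    by (simp add: order_of_carry_apply)
qed

text \<open>The defect \<open>f a b - f b a\<close> is the commutator pairing of the central extension defined by \<open>f\<close>, hence additive in \<open>b\<close>. Its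
values lie between \<open>-1\<close> and \<open>1\<close>, also at \<open>b\<^sup>2\<close>, where it doubles; so it vanishes.\<close>

lemma (in comm_group) carry_commute:
  assumes f: "carry_cocycle G f" and ab: "a \<in> carrier G" "b \<in> carrier G"
  shows "f a b = f b a"
proof -
  define g where "g x y = f x y - f y x" for x y
  have "g a (b \<otimes> b) = g a b + g a b"
  proof -
    have "f a b + f (a \<otimes> b) b = f b b + f a (b \<otimes> b)" by (rule carry_assoc[OF f ab ab(2)])
    moreover have "f b b + f (b \<otimes> b) a = f b a + f b (b \<otimes> a)" by (rule carry_assoc[OF f ab(2,2,1)])
    moreover have "f b a + f (b \<otimes> a) b = f a b + f b (a \<otimes> b)" by (rule carry_assoc[OF f ab(2,1,2)])
    ultimately show ?thesis using m_comm[OF ab] by (simp add: g_def)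
  qed
  moreover have "\<bar>g a (b \<otimes> b)\<bar> \<le> 1"
    using carry_values[OF f, of a "b \<otimes> b"] carry_values[OF f, of "b \<otimes> b" a] ab by (auto simp: g_def)
  ultimately show ?thesis by (simp add: g_def)
qed

section \<open>The ordered central extension\<close>

text \<open>The positive elements of a total invariant order on an abelian group.\<close>

definition total_cone :: "('g, 'm) monoid_scheme \<Rightarrow> 'g set \<Rightarrow> bool" where
  "total_cone H Q \<longleftrightarrow> Q \<subseteq> carrier H \<and> \<one>\<^bsub>H\<^esub> \<notin> Q \<and>
     (\<forall>x\<in>Q. \<forall>y\<in>Q. x \<otimes>\<^bsub>H\<^esub> y \<in> Q) \<and>
     (\<forall>x\<in>carrier H. x = \<one>\<^bsub>H\<^esub> \<or> x \<in> Q \<or> inv\<^bsub>H\<^esub> x \<in> Q)"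

lemma total_cone_D:
  assumes "total_cone H Q"
  shows total_cone_carrier: "Q \<subseteq> carrier H"
    and total_cone_one: "\<one>\<^bsub>H\<^esub> \<notin> Q"
    and total_cone_mult: "\<And>x y. x \<in> Q \<Longrightarrow> y \<in> Q \<Longrightarrow> x \<otimes>\<^bsub>H\<^esub> y \<in> Q"
    and total_cone_total: "\<And>x. x \<in> carrier H \<Longrightarrow> x \<noteq> \<one>\<^bsub>H\<^esub> \<Longrightarrow> x \<notin> Q \<Longrightarrow> inv\<^bsub>H\<^esub> x \<in> Q"
  using assms unfolding total_cone_def by blast+

lemma (in group) total_cone_inv:
  assumes "total_cone G Q" "x \<in> Q" shows "inv x \<notin> Q"
  using assms unfolding total_cone_def by (metis r_inv subsetD)

lemma (in group) total_cone_pow: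
  assumes Q: "total_cone G Q" and "x \<in> carrier G" "x \<noteq> \<one>" "n > 0" shows "x [^] (n::nat) \<noteq> \<one>"
proof -
  have pow: "y [^] n \<in> Q" if "y \<in> Q" for y
    using \<open>n > 0\<close>
  proof (induction n)
    case (Suc n)
    have "y \<in> carrier G" using total_cone_carrier[OF Q] that by blast
    then show ?case using Suc that total_cone_mult[OF Q] by (cases "n = 0") auto
  qed simp
  show ?thesis
  proof (cases "x \<in> Q")
    case True
    then show ?thesis using pow total_cone_one[OF Q] by metis
  next
    case False
    then have "inv x [^] n \<in> Q" using pow total_cone_total[OF Q] assms by blast
    then show ?thesis
      using total_cone_one[OF Q] assms(2) by (metis inv_one nat_pow_inv)
  qed
qed

lemma (in comm_group) total_cone_converse:
  assumes Q: "total_cone G Q"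
  shows "total_cone G {x \<in> carrier G. inv x \<in> Q}"
  using total_cone_D[OF Q] unfolding total_cone_def
  by (auto simp: inv_mult)

definition lex_cone :: "('g, 'm) monoid_scheme \<Rightarrow> ('g \<Rightarrow> rat) \<Rightarrow> 'g set \<Rightarrow> 'g set" where
  "lex_cone H h Q = {x \<in> carrier H. h x > 0 \<or> h x = 0 \<and> x \<in> Q}"

lemma (in group) total_cone_lex:
  assumes Q: "total_cone G Q" and h: "additive_on G h"
  shows "total_cone G (lex_cone G h Q)"
  unfolding total_cone_def
proof (intro conjI ballI)
  show "lex_cone G h Q \<subseteq> carrier G" by (auto simp: lex_cone_def)
  show "\<one> \<notin> lex_cone G h Q"
    using additive_on_one[OF h] total_cone_one[OF Q] by (auto simp: lex_cone_def)
next
  fix x y assume xy: "x \<in> lex_cone G h Q" "y \<in> lex_cone G h Q"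
  then have "h (x \<otimes> y) = h x + h y" using h by (auto simp: lex_cone_def additive_on_def)
  then show "x \<otimes> y \<in> lex_cone G h Q"
    using xy total_cone_mult[OF Q, of x y] by (auto simp: lex_cone_def)
next
  fix x assume x: "x \<in> carrier G"
  show "x = \<one> \<or> x \<in> lex_cone G h Q \<or> inv x \<in> lex_cone G h Q"
    using total_cone_total[OF Q x] additive_on_inv[OF h x] x by (auto simp: lex_cone_def)
qed

text \<open>The extension \<open>E\<close> unrolls the circle: \<open>(k, a)\<close> stands for the point of \<open>A\<close> over \<open>a\<close> after \<open>k\<close> full turns.\<close>

locale carry_group = comm_group G for G (structure) +
  fixes f :: "'a \<Rightarrow> 'a \<Rightarrow> int"
  assumes f: "carry_cocycle G f"
begin

definition E :: "(int \<times> 'a) monoid" where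
  "E = \<lparr>carrier = UNIV \<times> carrier G,
        mult = (\<lambda>x y. (fst x + fst y + f (snd x) (snd y), snd x \<otimes> snd y)),
        one = (0, \<one>)\<rparr>"

definition nonneg :: "(int \<times> 'a) set" where
  "nonneg = {0..} \<times> carrier G - {(0, \<one>)}"

lemma E_simps [simp]:
  "carrier E = UNIV \<times> carrier G" "\<one>\<^bsub>E\<^esub> = (0, \<one>)"
  "(k, a) \<otimes>\<^bsub>E\<^esub> (l, b) = (k + l + f a b, a \<otimes> b)"
  by (simp_all add: E_def)

lemma f_inv: "a \<in> carrier G \<Longrightarrow> f a (inv a) = nonid G a" "a \<in> carrier G \<Longrightarrow> f (inv a) a = nonid G a"
  using carry_inv[OF f, of a] carry_one[OF f, of \<one>] carry_commute[OF f, of "inv a" a]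
  by (auto simp: nonid_def)

lemma comm_group_E: "comm_group E"
proof (rule comm_groupI)
  fix x assume "x \<in> carrier E"
  then obtain k a where x: "x = (k, a)" "a \<in> carrier G" by auto
  then show "\<exists>y\<in>carrier E. y \<otimes>\<^bsub>E\<^esub> x = \<one>\<^bsub>E\<^esub>"
    using f_inv[of a] by (intro bexI[of _ "(- k - nonid G a, inv a)"]) auto
next
  fix x y z assume "x \<in> carrier E" "y \<in> carrier E" "z \<in> carrier E"
  then obtain k a l b m d where "x = (k, a)" "y = (l, b)" "z = (m, d)"
    "a \<in> carrier G" "b \<in> carrier G" "d \<in> carrier G"
    by auto
  then show "x \<otimes>\<^bsub>E\<^esub> y \<otimes>\<^bsub>E\<^esub> z = x \<otimes>\<^bsub>E\<^esub> (y \<otimes>\<^bsub>E\<^esub> z)"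
    using carry_assoc[OF f, of a b d] by (simp add: m_assoc)
qed (use carry_one[OF f] carry_commute[OF f] m_comm in auto)

sublocale E: comm_group E by (rule comm_group_E)

lemma inv_E: 
  assumes "a \<in> carrier G" shows "inv\<^bsub>E\<^esub> (k, a) = (- k - nonid G a, inv a)"
proof (rule E.inv_equality)
  show "(- k - nonid G a, inv a) \<otimes>\<^bsub>E\<^esub> (k, a) = \<one>\<^bsub>E\<^esub>"
    using assms f_inv[of a] by auto
qed (use assms in auto)

text \<open>Closure under multiplication uses \<open>f a (a\<inverse>) = 1\<close>: a product of two elements \<open>(0, a)\<close> and \<open>(0, a\<inverse>)\<close> lands at
\<open>(1, 1)\<close> and not at the identity. Totality holds because the inverse of \<open>(k, a)\<close> is \<open>(- k - 1, a\<inverse>)\<close> when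
\<open>a\<close> is not the identity.\<close>

lemma total_cone_nonneg: "total_cone E nonneg"
  unfolding total_cone_def
proof (intro conjI ballI)
  fix x y assume xy: "x \<in> nonneg" "y \<in> nonneg"
  then obtain k a l b where "x = (k, a)" "y = (l, b)" "a \<in> carrier G" "b \<in> carrier G" "k \<ge> 0" "l \<ge> 0"
      "k > 0 \<or> a \<noteq> \<one>" "l > 0 \<or> b \<noteq> \<one>"
    by (fastforce simp: nonneg_def)
  moreover have "f a b = 0 \<or> f a b = 1"
    using carry_values[OF f] \<open>a \<in> carrier G\<close> \<open>b \<in> carrier G\<close> by blast
  moreover have "f a b = 1" if "a \<otimes> b = \<one>" "a \<noteq> \<one>"
    using that f_inv(2)[of b] inv_equality[of a b] \<open>a \<in> carrier G\<close> \<open>b \<in> carrier G\<close>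
    by (auto simp: nonid_def)
  ultimately show "x \<otimes>\<^bsub>E\<^esub> y \<in> nonneg"
    by (auto simp: nonneg_def)
next
  fix x assume x: "x \<in> carrier E"
  then obtain k a where ka: "x = (k, a)" "a \<in> carrier G" by auto
  have "inv a = \<one> \<longleftrightarrow> a = \<one>" using ka(2) by (metis inv_inv inv_one)
  then show "x = \<one>\<^bsub>E\<^esub> \<or> x \<in> nonneg \<or> inv\<^bsub>E\<^esub> x \<in> nonneg"
    using ka inv_E[of a k] by (auto simp: nonneg_def nonid_def)
qed (auto simp: nonneg_def)

lemma shift_E: "a \<in> carrier G \<Longrightarrow> (k, \<one>) \<otimes>\<^bsub>E\<^esub> (l, a) = (k + l, a)"
  using carry_one[OF f] by simp

lemma cone_upward:
  assumes Q: "total_cone E Q" and z: "(1, \<one>) \<in> Q"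
    and ka: "(k, a) \<in> insert \<one>\<^bsub>E\<^esub> Q" "a \<in> carrier G" and kl: "k \<le> l"
  shows "(l, a) \<in> insert \<one>\<^bsub>E\<^esub> Q"
  using kl
proof (induction l rule: int_ge_induct)
  case base
  show ?case by (rule ka)
next
  case (step i)
  have "(1 + i, a) = (1, \<one>) \<otimes>\<^bsub>E\<^esub> (i, a)" using shift_E[OF ka(2)] by simp
  then show ?case
    using step z total_cone_mult[OF Q, of "(1, \<one>)" "(i, a)"] by (auto simp: add.commute)
qed

text \<open>The lift \<open>(n a, a)\<close> of \<open>a\<close> is the one in the half-open interval from the identity to \<open>z = (1, 1)\<close> for the order with
positive cone \<open>Q\<close>.\<close>

definition fundamental_section :: "(int \<times> 'a) set \<Rightarrow> ('a \<Rightarrow> int) \<Rightarrow> bool" where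
  "fundamental_section Q n \<longleftrightarrow>
     (\<forall>a\<in>carrier G. (n a, a) \<in> insert \<one>\<^bsub>E\<^esub> Q \<and> (n a - 1, a) \<notin> insert \<one>\<^bsub>E\<^esub> Q)"

lemma fundamental_section_eqI:
  assumes Q: "total_cone E Q" and z: "(1, \<one>) \<in> Q" and n: "fundamental_section Q n"
    and a: "a \<in> carrier G" and k: "(k, a) \<in> insert \<one>\<^bsub>E\<^esub> Q" "(k - 1, a) \<notin> insert \<one>\<^bsub>E\<^esub> Q"
  shows "n a = k"
proof -
  have na: "(n a, a) \<in> insert \<one>\<^bsub>E\<^esub> Q" "(n a - 1, a) \<notin> insert \<one>\<^bsub>E\<^esub> Q"
    using n a by (auto simp: fundamental_section_def)
  have "\<not> n a \<le> k - 1" using cone_upward[OF Q z na(1) a] k(2) by blast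
  moreover have "\<not> k \<le> n a - 1" using cone_upward[OF Q z k(1) a] na(2) by blast
  ultimately show ?thesis by simp
qed

lemma exists_fundamental_section:
  assumes Q: "total_cone E Q" and z: "(1, \<one>) \<in> Q"
    and cofinal: "\<And>a. a \<in> carrier G \<Longrightarrow> \<exists>k l. (k, a) \<in> insert \<one>\<^bsub>E\<^esub> Q \<and> (l, a) \<notin> insert \<one>\<^bsub>E\<^esub> Q"
  shows "\<exists>n. fundamental_section Q n"
proof -
  have "\<exists>k. (k, a) \<in> insert \<one>\<^bsub>E\<^esub> Q \<and> (k - 1, a) \<notin> insert \<one>\<^bsub>E\<^esub> Q" if a: "a \<in> carrier G" for a
  proof (rule ccontr)
    assume no: "\<not> ?thesis"
    obtain k l where kl: "(k, a) \<in> insert \<one>\<^bsub>E\<^esub> Q" "(l, a) \<notin> insert \<one>\<^bsub>E\<^esub> Q"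
      using cofinal[OF a] by blast
    have "l \<le> k" using cone_upward[OF Q z kl(1) a, of l] kl(2) by linarith
    moreover have "(j, a) \<in> insert \<one>\<^bsub>E\<^esub> Q" if "j \<le> k" for j
      using that
    proof (induction j rule: int_le_induct)
      case base
      show ?case by (rule kl(1))
    next
      case (step i)
      then show ?case using no by blast
    qed
    ultimately show False using kl(2) by blast
  qed
  then show ?thesis unfolding fundamental_section_def by metis
qed

text \<open>Any total order on \<open>E\<close> with \<open>z\<close> cofinal induces a circular order on \<open>A\<close>: its carry compares the product of the
lifts of \<open>a\<close> and \<open>b\<close>, which lies between the identity and \<open>z\<^sup>2\<close>, with the lift of \<open>a b\<close>.\<close>

lemma carry_cocycle_section:
  assumes Q: "total_cone E Q" and z: "(1, \<one>) \<in> Q" and n: "fundamental_section Q n"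
  shows "carry_cocycle G (\<lambda>a b. n a + n b + f a b - n (a \<otimes> b))"
proof -
  have na: "(n a, a) \<in> insert \<one>\<^bsub>E\<^esub> Q" "(n a - 1, a) \<notin> insert \<one>\<^bsub>E\<^esub> Q" if "a \<in> carrier G" for a
    using n that by (auto simp: fundamental_section_def)
  have neg: "inv\<^bsub>E\<^esub> (n a - 1, a) \<in> Q" if "a \<in> carrier G" for a
    using na(2)[OF that] total_cone_total[OF Q, of "(n a - 1, a)"] that by auto
  have one: "n \<one> = 0"
  proof (rule fundamental_section_eqI[OF Q z n])
    have "inv\<^bsub>E\<^esub> (1, \<one>) = (-1, \<one>)" using inv_E[of \<one> 1] by (simp add: nonid_def)
    then show "(0 - 1, \<one>) \<notin> insert \<one>\<^bsub>E\<^esub> Q" using E.total_cone_inv[OF Q z] by simp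
  qed auto
  have inv: "n (inv a) = - n a" if a: "a \<in> carrier G" "a \<noteq> \<one>" for a
  proof (rule fundamental_section_eqI[OF Q z n])
    have "inv\<^bsub>E\<^esub> (n a - 1, a) = (- n a, inv a)" using inv_E[of a "n a - 1"] a by (simp add: nonid_def)
    then show "(- n a, inv a) \<in> insert \<one>\<^bsub>E\<^esub> Q" using neg[OF a(1)] by simp
    have "inv\<^bsub>E\<^esub> (n a, a) = (- n a - 1, inv a)" using inv_E[of a "n a"] a by (simp add: nonid_def)
    moreover have "(n a, a) \<in> Q" using na(1)[OF a(1)] a(2) by simp
    moreover have "inv a \<noteq> \<one>" using a by (metis inv_inv inv_one)
    ultimately show "(- n a - 1, inv a) \<notin> insert \<one>\<^bsub>E\<^esub> Q" using E.total_cone_inv[OF Q] by fastforce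
  qed (use a in auto)
  have vals: "n a + n b + f a b - n (a \<otimes> b) = 0 \<or> n a + n b + f a b - n (a \<otimes> b) = 1"
    if ab: "a \<in> carrier G" "b \<in> carrier G" for a b
  proof -
    have abC: "a \<otimes> b \<in> carrier G" using ab by simp
    have "(n a, a) \<otimes>\<^bsub>E\<^esub> (n b, b) \<in> insert \<one>\<^bsub>E\<^esub> Q"
      using na(1)[OF ab(1)] na(1)[OF ab(2)] total_cone_mult[OF Q, of "(n a, a)" "(n b, b)"]
        E.l_one[of "(n b, b)"] E.r_one[of "(n a, a)"] ab by auto
    then have up: "(n a + n b + f a b, a \<otimes> b) \<in> insert \<one>\<^bsub>E\<^esub> Q" by simp
    have "\<not> n a + n b + f a b \<le> n (a \<otimes> b) - 1"
      using cone_upward[OF Q z up abC] na(2)[OF abC] by blast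
    moreover have "inv\<^bsub>E\<^esub> ((n a - 1, a) \<otimes>\<^bsub>E\<^esub> (n b - 1, b)) \<in> Q"
      using total_cone_mult[OF Q neg[OF ab(1)] neg[OF ab(2)]]
        E.inv_mult[of "(n a - 1, a)" "(n b - 1, b)"] ab by simp
    then have "(n a - 1, a) \<otimes>\<^bsub>E\<^esub> (n b - 1, b) \<notin> insert \<one>\<^bsub>E\<^esub> Q"
      using E.total_cone_inv[OF Q] E.inv_one total_cone_one[OF Q] by (metis insertE)
    then have down: "(n a + n b + f a b - 2, a \<otimes> b) \<notin> insert \<one>\<^bsub>E\<^esub> Q" by (simp add: algebra_simps)
    have "\<not> n (a \<otimes> b) \<le> n a + n b + f a b - 2"
      using cone_upward[OF Q z na(1)[OF abC] abC] down by blast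
    ultimately show ?thesis by linarith
  qed
  show ?thesis
    unfolding carry_cocycle_def
  proof (intro conjI ballI impI)
    fix a b d assume "a \<in> carrier G" "b \<in> carrier G" "d \<in> carrier G"
    then show "n a + n b + f a b - n (a \<otimes> b) + (n (a \<otimes> b) + n d + f (a \<otimes> b) d - n (a \<otimes> b \<otimes> d)) =
       n b + n d + f b d - n (b \<otimes> d) + (n a + n (b \<otimes> d) + f a (b \<otimes> d) - n (a \<otimes> (b \<otimes> d)))"
      using carry_assoc[OF f, of a b d] by (simp add: m_assoc)
  qed (use vals one inv carry_one[OF f] carry_inv[OF f] in auto)
qed

section \<open>Perturbing the order of the extension\<close>

lemma snd_pow_E: "snd (x [^]\<^bsub>E\<^esub> (n::nat)) = snd x [^] n"
  by (induction n) (auto simp: E_def nat_pow_def)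

lemma additive_on_E:
  assumes h: "additive_on E h" and h1: "h (1, \<one>) = 1" and a: "a \<in> carrier G"
  shows "h (k, a) = of_int k + h (0, a)"
proof -
  have add: "h (i + j, b) = h (i, \<one>) + h (j, b)" if "b \<in> carrier G" for i j b
    using h that shift_E[OF that, of i j] unfolding additive_on_def by (metis E_simps(1) SigmaI UNIV_I one_closed)
  have nat: "h (int n, \<one>) = of_nat n" for n
  proof (induction n)
    case 0
    show ?case using E.additive_on_one[OF h] by simp
  next
    case (Suc n)
    then show ?case using add[of \<one> 1 "int n"] h1 by simp
  qed
  have "h (k, \<one>) = of_int k"
  proof (cases k rule: int_cases2)
    case (nonneg n)
    then show ?thesis using nat by simp
  next
    case (nonpos n)
    then show ?thesis using nat[of n] add[of \<one> "int n" "- int n"] E.additive_on_one[OF h] by simp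
  qed
  then show ?thesis using add[OF a, of k 0] by simp
qed

text \<open>For \<open>b\<close> in \<open>B\<close>, other than the identity, both \<open>(0, b)\<close> and \<open>(0, b\<inverse>)\<close> are in \<open>T\<close>. If they stay positive, then
\<open>(0, b)\<close> remains the lift of \<open>b\<close> between the identity and \<open>z\<close>, since \<open>(-1, b)\<close> is the inverse of \<open>(0, b\<inverse>)\<close>; so
the carry does not change on \<open>B\<close>. The two new orders differ on the elements of the kernel of \<open>h\<close>, which are
infinitely small compared to \<open>z\<close>. Let \<open>(k, b)\<close> be one of them. If it is positive, then it and its square are the lifts of
\<open>b\<close> and \<open>b\<^sup>2\<close>, and adding \<open>b\<close> to itself does not carry. If it is negative, then the lifts are \<open>z\<close> times these elements,
and adding \<open>b\<close> to itself carries.\<close>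

lemma exists_nearby_carry:
  assumes B: "finite B" "B \<subseteq> carrier G"
    and a: "a \<in> carrier G" "\<And>n::nat. n > 0 \<Longrightarrow> a [^] n \<noteq> \<one>"
  shows "\<exists>f'. carry_cocycle G f' \<and> (\<forall>x\<in>B. \<forall>y\<in>B. x \<otimes> y \<in> B \<longrightarrow> f' x y = f x y) \<and>
           (\<exists>x\<in>carrier G. \<exists>y\<in>carrier G. f' x y \<noteq> f x y)"
proof -
  define B' where "B' = B \<union> (\<lambda>b. inv b) ` B - {\<one>}"
  define T where "T = insert (1, \<one>) ((\<lambda>b. (0::int, b)) ` B')"
  have B': "B' \<subseteq> carrier G - {\<one>}" using B by (auto simp: B'_def)
  have T: "finite T" "T \<subseteq> nonneg" using B B' by (auto simp: T_def B'_def nonneg_def)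
  obtain h0 where h0: "additive_on E h0" "\<And>x. x \<in> T \<Longrightarrow> h0 x > 0"
    using E.exists_additive_positive[OF total_cone_carrier[OF total_cone_nonneg]
        total_cone_one[OF total_cone_nonneg] total_cone_mult[OF total_cone_nonneg] T] by blast
  define h where "h x = h0 x / h0 (1, \<one>)" for x
  have h01: "h0 (1, \<one>) > 0" using h0(2) by (simp add: T_def)
  have h: "additive_on E h" "h (1, \<one>) = 1"
    using h0(1) h01 by (auto simp: additive_on_def h_def add_divide_distrib)
  have hT: "h x > 0" if "x \<in> T" for x
    using h0(2)[OF that] h01 by (simp add: h_def)
  note hk = additive_on_E[OF h]
  \<comment> \<open>A nontrivial kernel element: if \<open>h (0, a) = p / q\<close>, then the \<open>q\<close>-th power of \<open>(0, a)\<close> times \<open>z\<close> to the \<open>- p\<close>.\<close>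
  have "\<exists>k b. b \<in> carrier G \<and> (k, b) \<in> nonneg \<and> h (k, b) = 0"
  proof -
    obtain p q where pq: "h (0, a) = of_int p / of_int q" "q > 0"
      by (metis quotient_of_denom_pos quotient_of_div surj_pair)
    define y where "y = (0, a) [^]\<^bsub>E\<^esub> nat q"
    have "y \<in> carrier E" unfolding y_def by (rule E.nat_pow_closed) (use a in simp)
    moreover have sy: "snd y = a [^] nat q" by (simp add: y_def snd_pow_E)
    ultimately obtain j where y: "y = (j, a [^] nat q)" by (metis prod.collapse)
    have "h y = of_int p"
      using E.additive_on_pow[OF h(1), of "(0, a)" "nat q"] a pq by (simp add: y_def)
    then have h0: "h (j - p, a [^] nat q) = 0"
      using hk[of "a [^] nat q" j] hk[of "a [^] nat q" "j - p"] a y by simp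
    have b: "a [^] nat q \<in> carrier G" "a [^] nat q \<noteq> \<one>"
      using a(1) a(2)[of "nat q"] pq(2) by (simp_all del: pow_nat)
    show ?thesis
    proof (cases "(j - p, a [^] nat q) \<in> nonneg")
      case True
      then show ?thesis using h0 b by blast
    next
      case False
      then have "inv\<^bsub>E\<^esub> (j - p, a [^] nat q) \<in> nonneg"
        using total_cone_total[OF total_cone_nonneg, of "(j - p, a [^] nat q)"] b by simp
      moreover have "h (inv\<^bsub>E\<^esub> (j - p, a [^] nat q)) = 0"
        using E.additive_on_inv[OF h(1), of "(j - p, a [^] nat q)"] b h0 by simp
      ultimately show ?thesis using inv_E[OF b(1), of "j - p"] b by (metis inv_closed)
    qed
  qed
  then obtain k b where kb: "b \<in> carrier G" "(k, b) \<in> nonneg" "h (k, b) = 0" by blast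
  define R where "R s = (if s then nonneg else {x \<in> carrier E. inv\<^bsub>E\<^esub> x \<in> nonneg})" for s
  have R: "total_cone E (R s)" for s
    using total_cone_nonneg E.total_cone_converse[OF total_cone_nonneg] by (simp add: R_def)
  define Q where "Q s = lex_cone E h (R s)" for s
  have Q: "total_cone E (Q s)" for s unfolding Q_def by (rule E.total_cone_lex[OF R h(1)])
  have Qpos: "x \<in> Q s" if "x \<in> carrier E" "h x > 0" for x s
    using that by (simp add: Q_def lex_cone_def)
  have Qneg: "x \<notin> insert \<one>\<^bsub>E\<^esub> (Q s)" if "h x < 0" for x s
    using that E.additive_on_one[OF h(1)] by (auto simp: Q_def lex_cone_def)
  have z: "(1, \<one>) \<in> Q s" for s using Qpos h(2) by simp
  have "\<exists>n. fundamental_section (Q s) n" for s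
  proof (rule exists_fundamental_section[OF Q z])
    fix d assume d: "d \<in> carrier G"
    obtain i where "- h (0, d) < of_int i" by (meson ex_less_of_int)
    then have "h (i, d) > 0" using hk[OF d, of i] by simp
    moreover obtain l where "of_int l < - h (0, d)" by (meson ex_of_int_less)
    then have "h (l, d) < 0" using hk[OF d, of l] by simp
    ultimately show "\<exists>k l. (k, d) \<in> insert \<one>\<^bsub>E\<^esub> (Q s) \<and> (l, d) \<notin> insert \<one>\<^bsub>E\<^esub> (Q s)"
      using Qpos[of "(i, d)" s] Qneg[of "(l, d)" s] d by auto
  qed
  then obtain n where n: "\<And>s. fundamental_section (Q s) (n s)" by metis
  have n_eq: "n s d = j" if "d \<in> carrier G" "(j, d) \<in> insert \<one>\<^bsub>E\<^esub> (Q s)" "h (j - 1, d) < 0" for s d j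
    by (rule fundamental_section_eqI[OF Q z n that(1,2) Qneg[OF that(3)]])
  define F where "F s x y = n s x + n s y + f x y - n s (x \<otimes> y)" for s x y
  have F: "carry_cocycle G (F s)" for s
    unfolding F_def by (rule carry_cocycle_section[OF Q z n])
  have nB: "n s d = 0" if d: "d \<in> B" for s d
  proof (rule n_eq)
    show dC: "d \<in> carrier G" using B d by blast
    have ne: "h (0, d) > 0" "h (0, inv d) > 0" if "d \<noteq> \<one>"
    proof -
      have "inv d \<noteq> \<one>" using that dC by (metis inv_inv inv_one)
      then show "h (0, d) > 0" "h (0, inv d) > 0" using hT d that by (auto simp: T_def B'_def)
    qed
    show "(0, d) \<in> insert \<one>\<^bsub>E\<^esub> (Q s)" using Qpos[of "(0, d)" s] dC ne(1) by auto
    show "h (0 - 1, d) < 0"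
    proof (cases "d = \<one>")
      case True
      then show ?thesis using hk[of \<one> "-1"] E.additive_on_one[OF h(1)] by simp
    next
      case False
      then have "h (0, inv d) = - h (-1, d)"
        using E.additive_on_inv[OF h(1), of "(-1, d)"] inv_E[OF dC, of "-1"] dC by (simp add: nonid_def)
      then show ?thesis using ne(2)[OF False] by simp
    qed
  qed
  have n_ker: "n True d = j \<and> n False d = j + 1" if d: "d \<in> carrier G" "(j, d) \<in> nonneg" "h (j, d) = 0" for j d
  proof
    have "h (j - 1, d) < 0" using hk[OF d(1), of "j - 1"] hk[OF d(1), of j] d(3) by simp
    then show "n True d = j" using n_eq[of d j True] d by (simp add: Q_def R_def lex_cone_def)
    have "h (j + 1, d) > 0" using hk[OF d(1), of "j + 1"] hk[OF d(1), of j] d(3) by simp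
    then have "(j + 1, d) \<in> insert \<one>\<^bsub>E\<^esub> (Q False)" using Qpos[of "(j + 1, d)" False] d by simp
    moreover have "(j + 1 - 1, d) \<notin> insert \<one>\<^bsub>E\<^esub> (Q False)"
      using d E.total_cone_inv[OF total_cone_nonneg d(2)] total_cone_one[OF total_cone_nonneg]
      by (auto simp: Q_def R_def lex_cone_def)
    ultimately show "n False d = j + 1" by (rule fundamental_section_eqI[OF Q z n d(1)])
  qed
  have bb: "(k + k + f b b, b \<otimes> b) \<in> nonneg" "h (k + k + f b b, b \<otimes> b) = 0"
  proof -
    show "(k + k + f b b, b \<otimes> b) \<in> nonneg"
      using total_cone_mult[OF total_cone_nonneg kb(2,2)] by simp
    have "h ((k, b) \<otimes>\<^bsub>E\<^esub> (k, b)) = h (k, b) + h (k, b)"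
      using bspec[OF bspec[OF h(1)[unfolded additive_on_def], of "(k, b)"], of "(k, b)"] kb(1) by simp
    then show "h (k + k + f b b, b \<otimes> b) = 0" using kb(3) by simp
  qed
  have "F True b b = 0" "F False b b = 1"
    using n_ker[OF kb] n_ker[OF _ bb] kb(1) by (simp_all add: F_def)
  then obtain s where "F s b b \<noteq> f b b" by (metis zero_neq_one)
  moreover have "\<forall>x\<in>B. \<forall>y\<in>B. x \<otimes> y \<in> B \<longrightarrow> F s x y = f x y"
    using nB by (simp add: F_def)
  ultimately show ?thesis using F[of s] kb(1) by blast
qed

end

section \<open>Torsion groups\<close>

text \<open>The number of turns made by the \<open>m\<close>-th power of \<open>(0, a)\<close> is at most \<open>m\<close>, and it determines \<open>a\<close> among the
solutions of \<open>a ^ m = 1\<close> because the ordered group \<open>E\<close> is torsion-free.\<close>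

lemma (in carry_group) finite_torsion:
  assumes m: "m > 0" shows "finite {a \<in> carrier G. a [^] (m::nat) = \<one>}"
proof -
  define wind where "wind n a = fst ((0, a) [^]\<^bsub>E\<^esub> (n::nat))" for n a
  have pow: "(0, a) [^]\<^bsub>E\<^esub> n = (wind n a, a [^] n)" for n a
    using snd_pow_E[of "(0, a)" n] by (metis prod.collapse snd_conv wind_def)
  have wind: "0 \<le> wind n a \<and> wind n a \<le> int n" if a: "a \<in> carrier G" for n a
  proof (induction n)
    case 0
    show ?case by (simp add: wind_def)
  next
    case (Suc n)
    have "(0, a) [^]\<^bsub>E\<^esub> Suc n = (wind n a + f (a [^] n) a, a [^] n \<otimes> a)"
      using pow[of a n] by simp
    then have "wind (Suc n) a = wind n a + f (a [^] n) a" by (simp add: wind_def)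
    then show ?case using Suc carry_values[OF f, of "a [^] n" a] a by auto
  qed
  have "inj_on (wind m) {a \<in> carrier G. a [^] m = \<one>}"
  proof (rule inj_onI)
    fix a b assume a: "a \<in> {a \<in> carrier G. a [^] m = \<one>}" and b: "b \<in> {a \<in> carrier G. a [^] m = \<one>}"
      and eq: "wind m a = wind m b"
    let ?x = "(0, a)" and ?y = "(0, b)"
    have C: "?x \<in> carrier E" "?y \<in> carrier E" using a b by auto
    have "?x [^]\<^bsub>E\<^esub> m = ?y [^]\<^bsub>E\<^esub> m" using pow[of a m] pow[of b m] a b eq by simp
    then have "(?x \<otimes>\<^bsub>E\<^esub> inv\<^bsub>E\<^esub> ?y) [^]\<^bsub>E\<^esub> m = \<one>\<^bsub>E\<^esub>"
      using C E.pow_mult_distrib[of ?x "inv\<^bsub>E\<^esub> ?y" m] E.nat_pow_inv[of ?y m] E.m_comm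
      by (simp del: E_simps)
    then have "?x \<otimes>\<^bsub>E\<^esub> inv\<^bsub>E\<^esub> ?y = \<one>\<^bsub>E\<^esub>"
      using E.total_cone_pow[OF total_cone_nonneg E.m_closed[OF C(1) E.inv_closed[OF C(2)]] _ m] by blast
    then have "?x = ?y" using C E.inv_equality[of ?x "inv\<^bsub>E\<^esub> ?y"] by (simp del: E_simps)
    then show "a = b" by simp
  qed
  moreover have "wind m ` {a \<in> carrier G. a [^] m = \<one>} \<subseteq> {0..int m}" using wind by auto
  ultimately show ?thesis using finite_imageD finite_subset by blast
qed

text \<open>On elements of order dividing \<open>M\<close>, raising to the power \<open>e\<close> is \<open>x \<mapsto> x ^ (1 + p ^ k)\<close> on the \<open>p\<close>-part and the identity on
the prime-to-\<open>p\<close> part. Quantifying over all divisors of \<open>M\<close> makes the property pass to divisors, so that the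
exponents chosen for different elements are compatible.\<close>

definition twisting_exponent :: "nat \<Rightarrow> nat \<Rightarrow> nat \<Rightarrow> nat \<Rightarrow> bool" where
  "twisting_exponent p k M e \<longleftrightarrow>
     (\<forall>i. p ^ i dvd M \<longrightarrow> [e = 1 + p ^ k] (mod p ^ i)) \<and>
     (\<forall>m. m dvd M \<longrightarrow> coprime p m \<longrightarrow> [e = 1] (mod m))"

lemma twisting_exponent_dvd:
  "twisting_exponent p k M e \<Longrightarrow> d dvd M \<Longrightarrow> twisting_exponent p k d e"
  unfolding twisting_exponent_def by (meson dvd_trans)

lemma prime_part:
  fixes p M :: nat
  assumes "prime p" "M > 0"
  obtains j m where "M = p ^ j * m" "coprime p m"
proof -
  obtain m where m: "M = p ^ multiplicity p M * m" "\<not> p dvd m"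
    using assms multiplicity_decompose'[of M p] not_prime_unit[of p] by blast
  then show thesis using that[of _ m] prime_imp_coprime[OF assms(1)] by blast
qed

lemma exists_twisting_exponent:
  assumes p: "prime p" and M: "M > 0"
  shows "\<exists>e. twisting_exponent p k M e"
proof -
  obtain j m where M': "M = p ^ j * m" "coprime p m" using prime_part[OF assms] .
  have cop: "coprime (p ^ j) m" using M'(2) by simp
  obtain e where e: "[e = 1 + p ^ k] (mod p ^ j)" "[e = 1] (mod m)"
    using binary_chinese_remainder_nat[OF cop] by blast
  have "p ^ i dvd p ^ j" if "p ^ i dvd M" for i
    using that M' coprime_dvd_mult_left_iff[of "p ^ i" m "p ^ j"] by simp
  moreover have "d dvd m" if "d dvd M" "coprime p d" for d
    using that M' coprime_dvd_mult_right_iff[of d "p ^ j" m] by (simp add: coprime_commute)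
  ultimately have "twisting_exponent p k M e"
    unfolding twisting_exponent_def using e by (meson cong_dvd_modulus_nat)
  then show ?thesis by blast
qed

lemma twisting_exponent_cong:
  assumes p: "prime p" and M: "M > 0"
    and e: "twisting_exponent p k M e" "twisting_exponent p k M e'"
  shows "[e = e'] (mod M)"
proof -
  obtain j m where M': "M = p ^ j * m" "coprime p m" using prime_part[OF p M] .
  have "[e = e'] (mod p ^ j)" "[e = e'] (mod m)"
    using e M' unfolding twisting_exponent_def by (meson cong_sym cong_trans dvd_triv_left dvd_triv_right)+
  then show ?thesis using M' by (simp add: coprime_cong_mult_nat)
qed

text \<open>The condition on \<open>k\<close> excludes only \<open>p = 2\<close> with \<open>k = 0\<close>, where \<open>1 + p ^ k\<close> is divisible by \<open>p\<close>.\<close>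

lemma twisting_exponent_coprime:
  assumes p: "prime p" and k: "k > 0 \<or> odd p" and M: "M > 0" and e: "twisting_exponent p k M e"
  shows "coprime e M"
proof -
  obtain j m where M': "M = p ^ j * m" "coprime p m" using prime_part[OF p M] .
  have "coprime (1 + p ^ k) p"
  proof (cases "k = 0")
    case True
    then show ?thesis using k by (simp add: numeral_2_eq_2[symmetric])
  next
    case False
    then have "p dvd p ^ k" by simp
    then show ?thesis
      by (metis add.commute coprime_1_left coprime_add_one_left coprime_common_divisor coprime_divisors dvd_refl)
  qed
  then have "coprime (1 + p ^ k) (p ^ j)" by simp
  then have "coprime e (p ^ j)"
    using e M' unfolding twisting_exponent_def by (meson cong_imp_coprime cong_sym dvd_triv_left)
  moreover have "coprime e m"
    using e M' unfolding twisting_exponent_def by (meson cong_imp_coprime cong_sym coprime_1_left dvd_triv_right)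
  ultimately show ?thesis using M' by simp
qed

definition (in group) twist :: "nat \<Rightarrow> nat \<Rightarrow> 'a \<Rightarrow> 'a" where
  "twist p k x = x [^] (SOME e. twisting_exponent p k (ord x) e)"

lemma (in group) pow_cong:
  assumes x: "x \<in> carrier G" and e: "[e = e'] (mod ord x)"
  shows "x [^] (e::nat) = x [^] (e'::nat)"
proof -
  have "x [^] e = x [^] (e mod ord x)" for e :: nat
  proof -
    have "x [^] (ord x * (e div ord x) + e mod ord x) = x [^] (e mod ord x)"
      using x by (simp only: nat_pow_mult[symmetric] nat_pow_pow[symmetric] pow_ord_eq_1 nat_pow_one
          l_one nat_pow_closed)
    then show ?thesis by simp
  qed
  then show ?thesis using e by (metis cong_def)
qed

text \<open>The exponent may be chosen for any multiple \<open>M\<close> of the order, so that one exponent serves finitely many elements; this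
is what makes \<open>twist\<close> multiplicative.\<close>

lemma (in group) twist_eq:
  assumes x: "x \<in> carrier G" "ord x dvd M" and M: "M > 0" and p: "prime p"
    and e: "twisting_exponent p k M e"
  shows "twist p k x = x [^] e"
proof -
  have pos: "ord x > 0" using x(2) M by (metis dvd_0_left gr0I)
  have "twisting_exponent p k (ord x) (SOME e. twisting_exponent p k (ord x) e)"
    using exists_twisting_exponent[OF p pos] by (rule someI_ex)
  then have "[(SOME e. twisting_exponent p k (ord x) e) = e] (mod ord x)"
    by (rule twisting_exponent_cong[OF p pos _ twisting_exponent_dvd[OF e x(2)]])
  then show ?thesis unfolding twist_def by (rule pow_cong[OF x(1)])
qed

lemma (in comm_group) twist_mult:
  assumes x: "x \<in> carrier G" "ord x > 0" and y: "y \<in> carrier G" "ord y > 0" and p: "prime p"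
  shows "twist p k (x \<otimes> y) = twist p k x \<otimes> twist p k y"
proof -
  have M: "ord x * ord y > 0" using x y by simp
  then obtain e where e: "twisting_exponent p k (ord x * ord y) e"
    using exists_twisting_exponent[OF p] by blast
  have "ord (x \<otimes> y) dvd ord x * ord y" using x y by (simp add: abelian_ord_mul_divides)
  then show ?thesis
    using twist_eq[OF _ _ M p e] x y by (simp add: pow_mult_distrib m_comm)
qed

lemma (in group) twist_kernel:
  assumes x: "x \<in> carrier G" "ord x > 0" and p: "prime p" and k: "k > 0 \<or> odd p"
    and "twist p k x = \<one>"
  shows "x = \<one>"
proof -
  obtain e where e: "twisting_exponent p k (ord x) e"
    using exists_twisting_exponent[OF p x(2)] by blast
  have "x [^] e = \<one>" using twist_eq[OF x(1) dvd_refl x(2) p e] assms(5) by simp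
  then have "ord x dvd e" using pow_eq_id x by simp
  then have "ord x = 1"
    using twisting_exponent_coprime[OF p k x(2) e] by (metis coprime_common_divisor_nat dvd_refl)
  then show ?thesis using ord_eq_1 x by simp
qed

lemma (in group) twist_fixes:
  assumes x: "x \<in> carrier G" "x [^] N = \<one>" and N: "N > 0" "\<not> p ^ Suc k dvd N" and p: "prime p"
  shows "twist p k x = x"
proof -
  have dvd: "ord x dvd N" using x pow_eq_id by simp
  then have pos: "ord x > 0" using N by (metis dvd_0_left gr0I)
  then obtain e where e: "twisting_exponent p k (ord x) e" using exists_twisting_exponent[OF p] by blast
  obtain j m where jm: "ord x = p ^ j * m" "coprime p m" using prime_part[OF p pos] .
  have "j \<le> k"
  proof (rule ccontr)
    assume "\<not> j \<le> k"
    then have "p ^ Suc k dvd p ^ j" by (intro le_imp_power_dvd) simp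
    then have "p ^ Suc k dvd ord x" unfolding jm(1) by (rule dvd_mult2)
    then show False using N(2) dvd_trans[OF _ dvd] by blast
  qed
  then have "[1 + p ^ k = 1] (mod p ^ j)" 
    using cong_add_lcancel_0_nat[of 1 "p ^ k" "p ^ j"] by (simp add: cong_0_iff le_imp_power_dvd)
  moreover have "[e = 1 + p ^ k] (mod p ^ j)" "[e = 1] (mod m)"
    using e jm unfolding twisting_exponent_def by auto
  ultimately have "[e = 1] (mod p ^ j)" "[e = 1] (mod m)" using cong_trans by blast+
  then have "[e = 1] (mod ord x)" using jm by (simp add: coprime_cong_mult_nat)
  then have "x [^] e = x" using pow_cong[OF x(1)] x(1) by fastforce
  then show ?thesis using twist_eq[OF x(1) dvd_refl pos p e] by simp
qed

lemma (in group) twist_moves: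
  assumes x: "x \<in> carrier G" "ord x = p ^ Suc k" and p: "prime p"
  shows "twist p k x \<noteq> x"
proof
  assume eq: "twist p k x = x"
  have pos: "ord x > 0" using x p prime_gt_0_nat by simp
  then obtain e where e: "twisting_exponent p k (ord x) e" using exists_twisting_exponent[OF p] by blast
  then have "[e = 1 + p ^ k] (mod ord x)" using x(2) unfolding twisting_exponent_def by (metis dvd_refl)
  then have "x [^] e = x [^] (1 + p ^ k)" by (rule pow_cong[OF x(1)])
  also have "\<dots> = x \<otimes> x [^] (p ^ k)" using nat_pow_mult[OF x(1), of 1 "p ^ k"] x(1) by simp
  finally have "x \<otimes> x [^] (p ^ k) = x" using twist_eq[OF x(1) dvd_refl pos p e] eq by simp
  then have "x [^] (p ^ k) = \<one>" using x(1) by simp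
  then have "p ^ Suc k dvd p ^ k" using pow_eq_id x by simp
  then show False using prime_gt_1_nat[OF p] by (simp add: dvd_power_iff)
qed

definition pullback_order :: "'a set \<Rightarrow> ('a \<Rightarrow> 'a) \<Rightarrow> ('a \<times> 'a \<times> 'a \<Rightarrow> int) \<Rightarrow> ('a \<times> 'a \<times> 'a \<Rightarrow> int)" where
  "pullback_order S \<sigma> c = (\<lambda>(x, y, z)\<in>S \<times> S \<times> S. c (\<sigma> x, \<sigma> y, \<sigma> z))"

lemma pullback_order_in_CO:
  assumes c: "c \<in> CO G" and \<sigma>: "\<And>x. x \<in> carrier G \<Longrightarrow> \<sigma> x \<in> carrier G"
      "\<And>x y. x \<in> carrier G \<Longrightarrow> y \<in> carrier G \<Longrightarrow> \<sigma> (x \<otimes>\<^bsub>G\<^esub> y) = \<sigma> x \<otimes>\<^bsub>G\<^esub> \<sigma> y"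
    and inj: "inj_on \<sigma> (carrier G)" and G: "group G"
  shows "pullback_order (carrier G) \<sigma> c \<in> CO G"
proof (rule CO_I)
  fix x y z assume xyz: "x \<in> carrier G" "y \<in> carrier G" "z \<in> carrier G"
  show "pullback_order (carrier G) \<sigma> c (x, y, z) = 1 \<or> pullback_order (carrier G) \<sigma> c (x, y, z) = - 1 \<or>
      pullback_order (carrier G) \<sigma> c (x, y, z) = 0"
    using CO_values[OF c \<sigma>(1)[OF xyz(1)] \<sigma>(1)[OF xyz(2)] \<sigma>(1)[OF xyz(3)]] xyz
    by (simp add: pullback_order_def)
  show "(pullback_order (carrier G) \<sigma> c (x, y, z) = 0) = (x = y \<or> x = z \<or> y = z)"
    using CO_zero[OF c \<sigma>(1)[OF xyz(1)] \<sigma>(1)[OF xyz(2)] \<sigma>(1)[OF xyz(3)]] xyz inj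
    by (simp add: pullback_order_def inj_on_eq_iff)
  fix w assume w: "w \<in> carrier G"
  show "pullback_order (carrier G) \<sigma> c (x, y, z) - pullback_order (carrier G) \<sigma> c (w, y, z) +
       pullback_order (carrier G) \<sigma> c (w, x, z) - pullback_order (carrier G) \<sigma> c (w, x, y) = 0"
    using CO_cocycle[OF c \<sigma>(1)[OF w] \<sigma>(1)[OF xyz(1)] \<sigma>(1)[OF xyz(2)] \<sigma>(1)[OF xyz(3)]] xyz w
    by (simp add: pullback_order_def)
  show "pullback_order (carrier G) \<sigma> c (w \<otimes>\<^bsub>G\<^esub> x, w \<otimes>\<^bsub>G\<^esub> y, w \<otimes>\<^bsub>G\<^esub> z) =
       pullback_order (carrier G) \<sigma> c (x, y, z)"
    using CO_left[OF c \<sigma>(1)[OF w] \<sigma>(1)[OF xyz(1)] \<sigma>(1)[OF xyz(2)] \<sigma>(1)[OF xyz(3)]] xyz w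
    by (simp add: pullback_order_def \<sigma>(2) group.is_monoid[OF G] monoid.m_closed)
qed (auto simp: pullback_order_def restrict_def)

lemma CO_swap:
  assumes c: "c \<in> CO G" and "x \<in> carrier G" "y \<in> carrier G" "z \<in> carrier G"
  shows "c (x, z, y) = - c (x, y, z)"
  using CO_cocycle[OF c, of x y z y] CO_zero[OF c, of y z y] CO_zero[OF c, of x y y] assms by simp

lemma CO_trans:
  assumes c: "c \<in> CO G" and C: "w \<in> carrier G" "x \<in> carrier G" "y \<in> carrier G" "z \<in> carrier G"
    and "c (w, x, y) = 1" "c (w, y, z) = 1"
  shows "c (w, x, z) = 1"
  using CO_cocycle[OF c C] CO_values[OF c C(2,3,4)] CO_values[OF c C(1,2,4)] assms(6,7) by linarith

text \<open>Cutting the circle at the fixed point \<open>w\<close> makes \<open>F\<close> a finite linear order. Its elements are distinguished by the number of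
elements below them, which \<open>\<sigma>\<close> preserves.\<close>

lemma finite_order_automorphism_trivial:
  assumes c: "c \<in> CO G" and F: "finite F" "F \<subseteq> carrier G" and w: "w \<in> F" "\<sigma> w = w"
    and \<sigma>: "\<sigma> ` F \<subseteq> F" "inj_on \<sigma> F"
    and inv: "\<And>x y. x \<in> F \<Longrightarrow> y \<in> F \<Longrightarrow> c (w, \<sigma> x, \<sigma> y) = c (w, x, y)"
    and x: "x \<in> F"
  shows "\<sigma> x = x"
proof (rule ccontr)
  assume ne: "\<sigma> x \<noteq> x"
  define below where "below x = {y \<in> F. c (w, y, x) = 1}" for x
  have less: "card (below u) < card (below v)" if uv: "u \<in> F" "v \<in> F" "c (w, u, v) = 1" for u v
  proof (rule psubset_card_mono)
    have C: "w \<in> carrier G" "u \<in> carrier G" "v \<in> carrier G" using uv F(2) w(1) by blast+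
    have "below u \<subseteq> below v"
    proof
      fix y assume "y \<in> below u"
      then have y: "y \<in> F" "c (w, y, u) = 1" by (simp_all add: below_def)
      then have "y \<in> carrier G" using F(2) by blast
      then have "c (w, y, v) = 1" using CO_trans[OF c C(1) _ C(2,3) y(2) uv(3)] by blast
      then show "y \<in> below v" using y(1) by (simp add: below_def)
    qed
    moreover have "u \<in> below v" using uv by (simp add: below_def)
    moreover have "u \<notin> below u" using CO_zero[OF c C(1,2,2)] by (simp add: below_def)
    ultimately show "below u \<subset> below v" by blast
  qed (use F in \<open>simp add: below_def\<close>)
  have surj: "\<sigma> ` F = F" using endo_inj_surj[OF F(1) \<sigma>] .
  have "\<sigma> ` below x = below (\<sigma> x)"
  proof
    show "\<sigma> ` below x \<subseteq> below (\<sigma> x)" using inv x \<sigma>(1) by (auto simp: below_def)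
    show "below (\<sigma> x) \<subseteq> \<sigma> ` below x"
    proof
      fix y assume y: "y \<in> below (\<sigma> x)"
      then obtain y' where "y = \<sigma> y'" "y' \<in> F" using surj by (auto simp: below_def)
      then show "y \<in> \<sigma> ` below x" using y inv x by (auto simp: below_def)
    qed
  qed
  moreover have "inj_on \<sigma> (below x)" using \<sigma>(2) by (rule inj_on_subset) (auto simp: below_def)
  ultimately have eq: "card (below (\<sigma> x)) = card (below x)" by (metis card_image)
  have sx: "\<sigma> x \<in> F" using \<sigma> x by blast
  have C: "w \<in> carrier G" "x \<in> carrier G" "\<sigma> x \<in> carrier G" using x sx F(2) w(1) by blast+
  have "x \<noteq> w" using ne w(2) by blast
  moreover have "\<sigma> x \<noteq> w" using \<open>x \<noteq> w\<close> \<sigma>(2) w x by (metis inj_onD)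
  ultimately have "c (w, x, \<sigma> x) = 1 \<or> c (w, x, \<sigma> x) = -1"
    using CO_values[OF c C] CO_zero[OF c C] ne by metis
  then have "c (w, x, \<sigma> x) = 1 \<or> c (w, \<sigma> x, x) = 1"
    using CO_swap[OF c C] by auto
  then show False using less[OF x sx] less[OF sx x] eq by auto
qed

lemma (in comm_group) exists_nearby_order_torsion:
  assumes c: "c \<in> CO G" and inf: "infinite (carrier G)"
    and tors: "\<And>a. a \<in> carrier G \<Longrightarrow> ord a > 0"
    and S: "finite S" "S \<subseteq> carrier G"
  shows "\<exists>c'\<in>CO G. c' \<noteq> c \<and> (\<forall>x\<in>S. \<forall>y\<in>S. \<forall>z\<in>S. c' (x, y, z) = c (x, y, z))"
proof -
  interpret carry_group G "carry_of_order G c"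
    by unfold_locales (rule carry_cocycle_carry_of_order[OF c])
  \<comment> \<open>The factor \<open>2\<close> ensures \<open>k > 0\<close> below when \<open>p = 2\<close>, so that the twist is injective.\<close>
  define N where "N = 2 * (\<Prod>s\<in>S. ord s)"
  have N: "N > 0" using tors S by (auto simp: N_def intro: prod_pos)
  have SN: "s [^] N = \<one>" if "s \<in> S" for s
  proof -
    have "ord s dvd N" using that S by (simp add: N_def dvd_prodI)
    then show ?thesis using pow_eq_id that S by blast
  qed
  have "\<not> carrier G \<subseteq> {a \<in> carrier G. a [^] N = \<one>}"
    using finite_torsion[OF N] inf finite_subset by blast
  then obtain a where a: "a \<in> carrier G" "a [^] N \<noteq> \<one>" by blast
  have "\<not> ord a dvd N" using a pow_eq_id by blast
  then obtain p where p: "prime p" "multiplicity p N < multiplicity p (ord a)"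
    using multiplicity_le_imp_dvd[of "ord a" N] tors[OF a(1)] N
    by (metis linorder_not_le less_numeral_extra(3))
  define k where "k = multiplicity p N"
  have pN: "\<not> p ^ Suc k dvd N"
    using N not_prime_unit[of p] p(1) power_dvd_iff_le_multiplicity[of N p "Suc k"] unfolding k_def
    by (metis not_less_eq_eq order_refl less_numeral_extra(3))
  have k: "k > 0 \<or> odd p"
  proof (cases "p = 2")
    case True
    then have "2 dvd N" by (simp add: N_def)
    then show ?thesis using True N p(1) pN by (cases k) auto
  next
    case False
    then show ?thesis using p(1) by (metis primes_dvd_imp_eq two_is_prime_nat)
  qed
  have "p ^ Suc k dvd ord a" using p(2) by (intro multiplicity_dvd') (simp add: k_def)
  then obtain q where q: "ord a = p ^ Suc k * q" by (rule dvdE)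
  have "ord (a [^] q) = p ^ Suc k"
    using ord_pow[OF a(1), of q] q tors[OF a(1)] by simp
  then have b: "a [^] q \<in> carrier G" "ord (a [^] q) = p ^ Suc k" using a by auto
  let ?\<sigma> = "twist p k"
  have closed: "?\<sigma> x \<in> carrier G" if "x \<in> carrier G" for x using that by (simp add: twist_def)
  have mult: "?\<sigma> (x \<otimes> y) = ?\<sigma> x \<otimes> ?\<sigma> y" if "x \<in> carrier G" "y \<in> carrier G" for x y
    using twist_mult[OF that(1) tors[OF that(1)] that(2) tors[OF that(2)] p(1)] .
  have inj: "inj_on ?\<sigma> (carrier G)"
  proof (rule inj_onI)
    fix x y assume xy: "x \<in> carrier G" "y \<in> carrier G" "?\<sigma> x = ?\<sigma> y"
    have "?\<sigma> (x \<otimes> inv y) \<otimes> ?\<sigma> y = ?\<sigma> y"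
      using mult[of "x \<otimes> inv y" y] xy by (simp add: m_assoc)
    then have "?\<sigma> (x \<otimes> inv y) = \<one>" using xy closed by simp
    then have "x \<otimes> inv y = \<one>" using twist_kernel[OF _ tors p(1) k, of "x \<otimes> inv y"] xy by simp
    then show "x = y" using xy inv_equality[of x "inv y"] by simp
  qed
  define c' where "c' = pullback_order (carrier G) ?\<sigma> c"
  have "c' \<in> CO G" unfolding c'_def
    by (rule pullback_order_in_CO[OF c closed mult inj is_group])
  moreover have "c' (x, y, z) = c (x, y, z)" if "x \<in> S" "y \<in> S" "z \<in> S" for x y z
    using twist_fixes[OF _ SN N pN p(1)] that S(2) by (auto simp: c'_def pullback_order_def)
  moreover have "c' \<noteq> c"
  proof
    assume eq: "c' = c"
    define F where "F = {a \<in> carrier G. a [^] (p ^ Suc k) = \<one>}"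
    have "?\<sigma> (a [^] q) = a [^] q"
    proof (rule finite_order_automorphism_trivial[OF c])
      show "finite F" unfolding F_def by (rule finite_torsion) (use p(1) prime_gt_0_nat in simp)
      show "F \<subseteq> carrier G" by (auto simp: F_def)
      show "\<one> \<in> F" by (simp add: F_def)
      show one: "?\<sigma> \<one> = \<one>" by (simp add: twist_def)
      show "?\<sigma> ` F \<subseteq> F"
      proof
        fix y assume "y \<in> ?\<sigma> ` F"
        then obtain x e where x: "x \<in> F" "y = x [^] (e::nat)" by (auto simp: twist_def)
        have xC: "x \<in> carrier G" and x1: "x [^] (p ^ Suc k) = \<one>" using x by (auto simp: F_def)
        have "y [^] (p ^ Suc k) = (x [^] (p ^ Suc k)) [^] e"
          using x(2) nat_pow_pow[OF xC] by (simp only: mult.commute)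
        then have "y [^] (p ^ Suc k) = \<one>" using x1 by (simp only: nat_pow_one)
        then show "y \<in> F" using x(2) xC by (simp only: F_def mem_Collect_eq nat_pow_closed)
      qed
      show "inj_on ?\<sigma> F" using inj by (rule inj_on_subset) (auto simp: F_def)
      show "a [^] q \<in> F" using b pow_ord_eq_1[OF b(1)] by (simp add: F_def)
      fix x y assume "x \<in> F" "y \<in> F"
      then show "c (\<one>, ?\<sigma> x, ?\<sigma> y) = c (\<one>, x, y)"
        using arg_cong[OF eq, of "\<lambda>h. h (\<one>, x, y)"] one by (simp add: c'_def pullback_order_def F_def)
    qed
    then show False using twist_moves[OF b p(1)] by simp
  qed
  ultimately show ?thesis by blast
qed

section \<open>No circular order is isolated\<close>

lemma (in comm_group) exists_nearby_order:
  assumes c: "c \<in> CO G" and inf: "infinite (carrier G)" and S: "finite S" "S \<subseteq> carrier G"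
  shows "\<exists>c'\<in>CO G. c' \<noteq> c \<and> (\<forall>x\<in>S. \<forall>y\<in>S. \<forall>z\<in>S. c' (x, y, z) = c (x, y, z))"
proof (cases "\<forall>a\<in>carrier G. ord a > 0")
  case True
  then show ?thesis using exists_nearby_order_torsion[OF c inf _ S] by blast
next
  case False
  then obtain a where a: "a \<in> carrier G" "ord a = 0" by auto
  let ?f = "carry_of_order G c"
  interpret carry_group G ?f
    by unfold_locales (rule carry_cocycle_carry_of_order[OF c])
  define B where "B = (\<lambda>(x, y). inv x \<otimes> y) ` (S \<times> S)"
  have "finite B" "B \<subseteq> carrier G" using S by (auto simp: B_def)
  moreover have "a [^] n \<noteq> \<one>" if "n > 0" for n :: nat using a that ord_eq_0 by auto
  ultimately obtain f' where f': "carry_cocycle G f'"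
      "\<And>x y. x \<in> B \<Longrightarrow> y \<in> B \<Longrightarrow> x \<otimes> y \<in> B \<Longrightarrow> f' x y = ?f x y"
      "\<exists>x\<in>carrier G. \<exists>y\<in>carrier G. f' x y \<noteq> ?f x y"
    using exists_nearby_carry[of B a] a(1) by blast
  have c_eq: "c = order_of_carry G ?f" using order_of_carry_of_order[OF c] by simp
  have "order_of_carry G f' \<noteq> c"
    using f'(3) order_of_carry_cancel[of f' ?f] c_eq by metis
  moreover have "order_of_carry G f' (x, y, z) = c (x, y, z)" if xyz: "x \<in> S" "y \<in> S" "z \<in> S" for x y z
  proof -
    have C: "x \<in> carrier G" "y \<in> carrier G" "z \<in> carrier G" using xyz S by auto
    have "f' (inv x \<otimes> y) (inv y \<otimes> z) = ?f (inv x \<otimes> y) (inv y \<otimes> z)"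
      by (rule f'(2)) (use xyz inv_mult_inv_mult[OF C] in \<open>auto simp: B_def\<close>)
    then show ?thesis
      using order_of_carry_apply[OF C, of f'] order_of_carry_apply[OF C, of ?f] c_eq by simp
  qed
  ultimately show ?thesis using order_of_carry_in_CO[OF f'(1)] by blast
qed

section \<open>Cantor spaces\<close>

text \<open>A point is coded by the sequence of its memberships. Every sequence occurs, because the points with a given
finite initial code form a decreasing sequence of nonempty closed sets in a compact space.\<close>

lemma homeomorphic_bool_sequences:
  fixes D :: "nat \<Rightarrow> 'a set"
  assumes X: "compact_space X"
    and clopen: "\<And>n. openin X (D n)" "\<And>n. closedin X (D n)"
    and separates: "\<And>x y. x \<in> topspace X \<Longrightarrow> y \<in> topspace X \<Longrightarrow> (\<And>n. x \<in> D n \<longleftrightarrow> y \<in> D n) \<Longrightarrow> x = y"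
    and independent: "\<And>b n. \<exists>x\<in>topspace X. \<forall>i<n. x \<in> D i \<longleftrightarrow> b i"
  shows "X homeomorphic_space product_topology (\<lambda>_::nat. discrete_topology (UNIV :: bool set)) UNIV"
    (is "_ homeomorphic_space ?B")
proof -
  define \<phi> where "\<phi> x = (\<lambda>n. x \<in> D n)" for x
  have "continuous_map X (discrete_topology UNIV) (\<lambda>x. x \<in> D n)" for n
  proof -
    have eq: "{x \<in> topspace X. (x \<in> D n) \<in> U} =
        (if True \<in> U then D n else {}) \<union> (if False \<in> U then topspace X - D n else {})" for U
      using openin_subset[OF clopen(1)[of n]] by (auto split: if_splits) (metis (full_types))+
    show ?thesis
      unfolding continuous_map_def eq using clopen[of n] by (auto intro!: openin_Un openin_diff)
  qed
  then have cont: "continuous_map X ?B \<phi>"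
    unfolding \<phi>_def by (simp add: continuous_map_componentwise_UNIV)
  have haus: "Hausdorff_space ?B"
    by (simp add: Hausdorff_space_product_topology)
  have "\<phi> ` topspace X = topspace ?B"
  proof -
    have "b \<in> \<phi> ` topspace X" for b
    proof -
      define C where "C n = {x \<in> topspace X. \<forall>i<n. x \<in> D i \<longleftrightarrow> b i}" for n
      have C_Suc: "C (Suc n) = C n \<inter> (if b n then D n else topspace X - D n)" for n
        using openin_subset[OF clopen(1)[of n]] by (auto simp: C_def less_Suc_eq)
      have "closedin X (C n)" for n
      proof (induction n)
        case 0
        show ?case by (simp add: C_def)
      next
        case (Suc n)
        then show ?case unfolding C_Suc using clopen[of n] by (auto intro!: closedin_Int closedin_diff)
      qed
      moreover have "C n \<noteq> {}" for n using independent[of n b] by (auto simp: C_def)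
      moreover have "decseq C" by (auto simp: decseq_def C_def)
      ultimately have "(\<Inter>n. C n) \<noteq> {}" using X compact_space_imp_nest by blast
      then obtain x where "\<And>n. x \<in> C n" by blast
      then have "x \<in> topspace X" "\<phi> x = b" by (auto simp: C_def \<phi>_def)
      then show ?thesis by blast
    qed
    then show ?thesis by auto
  qed
  moreover have "inj_on \<phi> (topspace X)"
    using separates by (auto simp: inj_on_def \<phi>_def fun_eq_iff)
  ultimately have "homeomorphic_map X ?B \<phi>"
    using continuous_imp_homeomorphic_map[OF cont X haus] by blast
  then show ?thesis by (rule homeomorphic_map_imp_homeomorphic_space)
qed

definition splits :: "'a set \<Rightarrow> 'a set \<Rightarrow> bool" where
  "splits E U \<longleftrightarrow> U \<inter> E \<noteq> {} \<and> U - E \<noteq> {}"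

definition first_split :: "(nat \<Rightarrow> 'a set) \<Rightarrow> 'a set \<Rightarrow> nat" where
  "first_split E U = (LEAST i. splits (E i) U)"

text \<open>\<open>cell E S x n\<close> is obtained from \<open>S\<close> by \<open>n\<close> times cutting the current piece by the first \<open>E i\<close> that contains
some but not all of its points, and keeping the side of \<open>x\<close>.\<close>

primrec cell :: "(nat \<Rightarrow> 'a set) \<Rightarrow> 'a set \<Rightarrow> 'a \<Rightarrow> nat \<Rightarrow> 'a set" where
  "cell E S x 0 = S"
| "cell E S x (Suc n) = {y \<in> cell E S x n.
     y \<in> E (first_split E (cell E S x n)) \<longleftrightarrow> x \<in> E (first_split E (cell E S x n))}"

lemma cell_self: "x \<in> S \<Longrightarrow> x \<in> cell E S x n"
  by (induction n) auto

lemma cell_mono: "m \<le> n \<Longrightarrow> cell E S x n \<subseteq> cell E S x m"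
  by (induction rule: dec_induct) auto

lemma cell_eq: "y \<in> cell E S x n \<Longrightarrow> cell E S y n = cell E S x n"
  by (induction n) auto

lemma cell_eq_le: "y \<in> cell E S x n \<Longrightarrow> m \<le> n \<Longrightarrow> cell E S y m = cell E S x m"
  using cell_mono cell_eq by (metis subsetD)

text \<open>Brouwer's characterization of the Cantor space. Without isolated points every nonempty open set contains two points, so
each cell can be split again, and recording the sides gives a code in which all finite patterns occur. Codes
separate points: the indices used along one point are pairwise distinct, since a cell is never split by an
earlier index; but if \<open>E j\<close> separated two points with the same code, it would split all of their cells and
bound those indices by \<open>j\<close>.\<close>

theorem Cantor_space_characterization:
  fixes E :: "nat \<Rightarrow> 'a set"
  assumes X: "compact_space X" "topspace X \<noteq> {}"
    and perfect: "\<And>x. \<not> isolated_point X x"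
    and clopen: "\<And>n. openin X (E n)" "\<And>n. closedin X (E n)"
    and separates: "\<And>x y. x \<in> topspace X \<Longrightarrow> y \<in> topspace X \<Longrightarrow> (\<And>n. x \<in> E n \<longleftrightarrow> y \<in> E n) \<Longrightarrow> x = y"
  shows "X homeomorphic_space product_topology (\<lambda>_::nat. discrete_topology (UNIV :: bool set)) UNIV"
proof -
  let ?S = "topspace X"
  let ?c = "cell E ?S"
  let ?i = "\<lambda>x n. first_split E (?c x n)"
  have sub: "?c x n \<subseteq> ?S" for x n using cell_mono[of 0 n E ?S x] by simp
  have open_cell: "openin X (?c x n)" for x n
  proof (induction n)
    case (Suc n)
    have "?c x (Suc n) = ?c x n \<inter> (if x \<in> E (?i x n) then E (?i x n) else ?S - E (?i x n))"
      using sub[of x n] by auto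
    then show ?case using Suc clopen by (auto intro!: openin_Int openin_diff simp del: cell.simps)
  qed simp
  have split: "splits (E (?i x n)) (?c x n)" if x: "x \<in> ?S" for x n
  proof -
    have "?c x n \<noteq> {x}"
      using open_cell[of x n] perfect[of x] x unfolding isolated_point_def by metis
    then obtain y where y: "y \<in> ?c x n" "y \<noteq> x" using cell_self[OF x, of E n] by blast
    then obtain i where "x \<in> E i \<longleftrightarrow> y \<notin> E i" using separates[of x y] x sub[of x n] by blast
    then have "splits (E i) (?c x n)" using y(1) cell_self[OF x, of E n] by (auto simp: splits_def)
    then show ?thesis unfolding first_split_def by (rule LeastI)
  qed
  define D where "D n = {x \<in> ?S. x \<in> E (?i x n)}" for n
  have D_cell: "y \<in> D n \<longleftrightarrow> x \<in> D n" if "x \<in> ?S" "y \<in> ?c x (Suc n)" for x y n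
    using that cell_eq[of y E ?S x n] sub[of x n] by (auto simp: D_def)
  have open_saturated: "openin X A" if "A \<subseteq> ?S" "\<And>x. x \<in> A \<Longrightarrow> ?c x (Suc n) \<subseteq> A" for A n
    using openin_subopen[of X A] that open_cell cell_self by (metis subsetD)
  show ?thesis
  proof (rule homeomorphic_bool_sequences[OF X(1), of D])
    show "openin X (D n)" for n
      by (rule open_saturated[of _ n]) (use D_cell[of _ _ n] in \<open>auto simp: D_def simp del: cell.simps\<close>)
    have "openin X (?S - D n)" for n
      by (rule open_saturated[of _ n]) (use D_cell[of _ _ n] sub in blast)+
    then show "closedin X (D n)" for n by (auto simp: closedin_def D_def)
  next
    fix x y assume xy: "x \<in> ?S" "y \<in> ?S" and eq: "\<And>n. x \<in> D n \<longleftrightarrow> y \<in> D n"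
    have y_cell: "y \<in> ?c x n" for n
    proof (induction n)
      case (Suc n)
      have "?c y n = ?c x n" by (rule cell_eq[OF Suc])
      then show ?case using Suc eq[of n] xy by (auto simp: D_def)
    qed (use xy in simp)
    show "x = y"
    proof (rule ccontr)
      assume "x \<noteq> y"
      then obtain j where j: "x \<in> E j \<longleftrightarrow> y \<notin> E j" using separates[OF xy] by blast
      have "splits (E j) (?c x n)" for n
        using j y_cell[of n] cell_self[OF xy(1), of E n] by (auto simp: splits_def)
      then have le: "?i x n \<le> j" for n unfolding first_split_def by (rule Least_le)
      have "?i x m \<noteq> ?i x n" if "m < n" for m n
      proof
        assume eq_i: "?i x m = ?i x n"
        have "?c x n \<subseteq> ?c x (Suc m)" using that by (intro cell_mono) simp
        then have "\<not> splits (E (?i x m)) (?c x n)" by (auto simp: splits_def)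
        then show False using split[OF xy(1), of n] eq_i by simp
      qed
      then have "inj (?i x)" by (metis linorder_injI)
      moreover have "range (?i x) \<subseteq> {..j}" using le by auto
      ultimately show False using finite_imageD finite_subset infinite_UNIV_nat by blast
    qed
  next
    fix b :: "nat \<Rightarrow> bool" and n
    show "\<exists>x\<in>?S. \<forall>i<n. x \<in> D i \<longleftrightarrow> b i"
    proof (induction n)
      case 0
      obtain x where "x \<in> ?S" using X(2) by blast
      then show ?case by auto
    next
      case (Suc n)
      then obtain x where x: "x \<in> ?S" "\<And>i. i < n \<Longrightarrow> x \<in> D i \<longleftrightarrow> b i" by blast
      obtain y where y: "y \<in> ?c x n" "y \<in> E (?i x n) \<longleftrightarrow> b n"
        using split[OF x(1), of n] unfolding splits_def by (cases "b n") auto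
      have yS: "y \<in> ?S" using sub y(1) by blast
      have "y \<in> D n \<longleftrightarrow> b n" using y(2) yS cell_eq[OF y(1)] by (simp add: D_def)
      moreover have "y \<in> D i \<longleftrightarrow> b i" if i: "i < n" for i
      proof -
        have "y \<in> ?c x (Suc i)" using cell_mono[of "Suc i" n E ?S x] i y(1) by (meson Suc_leI subsetD)
        then show ?thesis using D_cell[OF x(1)] x(2)[OF i] by blast
      qed
      ultimately show ?case using yS by (auto simp: less_Suc_eq)
    qed
  qed
qed

section \<open>The middle-thirds Cantor set\<close>

lemma cantor_stage_subset: "cantor_stage n \<subseteq> {0..1}"
  by (induction n) (auto simp: subset_eq)

lemma compact_cantor_stage: "compact (cantor_stage n)"
  by (induction n) (auto intro!: compact_Un compact_continuous_image continuous_intros)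

lemma cantor_set_subset: "cantor_set \<subseteq> {0..1}"
  unfolding cantor_set_def using cantor_stage_subset by blast

lemma compact_cantor_set: "compact cantor_set"
proof -
  have "closed cantor_set"
    unfolding cantor_set_def using compact_cantor_stage compact_imp_closed by blast
  then have "compact ({0..1} \<inter> cantor_set)" by (rule compact_Int_closed[OF compact_Icc])
  then show ?thesis using cantor_set_subset by (simp add: Int_absorb1)
qed

lemma cantor_set_third:
  assumes "x \<in> cantor_set"
  shows "x / 3 \<in> cantor_set" "2 / 3 + x / 3 \<in> cantor_set"
proof -
  have "x / 3 \<in> cantor_stage n \<and> 2 / 3 + x / 3 \<in> cantor_stage n" for n
    using assms cantor_set_subset by (cases n) (auto simp: cantor_set_def)
  then show "x / 3 \<in> cantor_set" "2 / 3 + x / 3 \<in> cantor_set" by (auto simp: cantor_set_def)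
qed

lemma zero_in_cantor_set: "0 \<in> cantor_set"
proof -
  have "0 \<in> cantor_stage n" for n by (induction n) auto
  then show ?thesis by (simp add: cantor_set_def)
qed

text \<open>The shift of ternary expansions. The cut at \<open>1/2\<close> lies in the gap between the two thirds of the Cantor set, where it does
not affect continuity; the position relative to it is the first ternary digit.\<close>

definition cantor_shift :: "real \<Rightarrow> real" where
  "cantor_shift x = (if x \<le> 1/2 then 3 * x else 3 * x - 2)"

lemma cantor_set_gap:
  assumes "x \<in> cantor_set" shows "x \<le> 1/3 \<or> x \<ge> 2/3"
proof -
  have "x \<in> cantor_stage (Suc 0)" using assms unfolding cantor_set_def by blast
  then show ?thesis by auto
qed

lemma cantor_shift_in:
  assumes x: "x \<in> cantor_set" shows "cantor_shift x \<in> cantor_set"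
proof -
  have "cantor_shift x \<in> cantor_stage n" for n
  proof -
    have "x \<in> cantor_stage (Suc n)" using x unfolding cantor_set_def by blast
    then obtain y where y: "y \<in> cantor_stage n" "x = y / 3 \<or> x = 2 / 3 + y / 3" by auto
    moreover have "0 \<le> y" "y \<le> 1" using cantor_stage_subset[of n] y(1) by auto
    ultimately have "cantor_shift x = y" by (auto simp: cantor_shift_def)
    then show ?thesis using y(1) by simp
  qed
  then show ?thesis by (simp add: cantor_set_def)
qed

lemma cantor_shift_iterate_in: "x \<in> cantor_set \<Longrightarrow> (cantor_shift ^^ n) x \<in> cantor_set"
  by (induction n) (auto intro: cantor_shift_in)

lemma continuous_on_cantor_shift: "continuous_on cantor_set cantor_shift"
proof -
  have "continuous_on (cantor_set \<inter> {..1/3} \<union> cantor_set \<inter> {2/3..})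
      (\<lambda>x. if x \<le> 1/2 then 3 * x else 3 * x - 2)"
    by (rule continuous_on_If)
       (auto intro!: continuous_intros closed_Int compact_imp_closed compact_cantor_set)
  moreover have "cantor_set \<inter> {..1/3} \<union> cantor_set \<inter> {2/3..} = cantor_set"
    by (auto dest: cantor_set_gap)
  ultimately show ?thesis by (simp add: cantor_shift_def[abs_def])
qed

lemma continuous_on_cantor_shift_iterate: "continuous_on cantor_set (cantor_shift ^^ n)"
proof (induction n)
  case (Suc n)
  have "continuous_on ((cantor_shift ^^ n) ` cantor_set) cantor_shift"
    by (rule continuous_on_subset[OF continuous_on_cantor_shift]) (auto intro: cantor_shift_iterate_in)
  then show ?case using continuous_on_compose[OF Suc] by simp
qed (simp add: id_def)

lemma cantor_set_homeomorphic_bool_sequences: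
  "top_of_set cantor_set homeomorphic_space
     product_topology (\<lambda>_::nat. discrete_topology (UNIV :: bool set)) UNIV"
proof (rule homeomorphic_bool_sequences)
  let ?T = "\<lambda>n. cantor_shift ^^ n"
  define D where "D n = {x \<in> cantor_set. ?T n x > 1/2}" for n
  show "compact_space (top_of_set cantor_set)"
    using compact_cantor_set by (simp add: compact_space_subtopology)
  have "D n = cantor_set \<inter> ?T n -` {1/2<..}" for n by (auto simp: D_def)
  then show "openin (top_of_set cantor_set) (D n)" for n
    using continuous_openin_preimage_gen[OF continuous_on_cantor_shift_iterate, of "{1/2<..}" n] by simp
  have "D n = cantor_set \<inter> ?T n -` {2/3..}" for n
  proof -
    have "?T n x > 1/2 \<longleftrightarrow> ?T n x \<ge> 2/3" if "x \<in> cantor_set" for x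
      using cantor_set_gap[OF cantor_shift_iterate_in[OF that, of n]] by auto
    then show ?thesis by (auto simp: D_def)
  qed
  then show "closedin (top_of_set cantor_set) (D n)" for n
    using continuous_closedin_preimage[OF continuous_on_cantor_shift_iterate, of "{2/3..}" n] by simp
  show "x = y" if x: "x \<in> topspace (top_of_set cantor_set)" and y: "y \<in> topspace (top_of_set cantor_set)"
    and eq: "\<And>n. x \<in> D n \<longleftrightarrow> y \<in> D n" for x y
  proof (rule ccontr)
    assume ne: "x \<noteq> y"
    have xy: "x \<in> cantor_set" "y \<in> cantor_set" using x y by auto
    have "?T n x - ?T n y = 3 ^ n * (x - y)" for n
    proof (induction n)
      case (Suc n)
      have "?T n x > 1/2 \<longleftrightarrow> ?T n y > 1/2" using eq[of n] xy by (simp add: D_def)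
      then have "cantor_shift (?T n x) - cantor_shift (?T n y) = 3 * (?T n x - ?T n y)"
        by (auto simp: cantor_shift_def)
      then show ?case using Suc by simp
    qed simp
    moreover have "\<bar>?T n x - ?T n y\<bar> \<le> 1" for n
    proof -
      have "?T n x \<in> {0..1}" "?T n y \<in> {0..1}" using xy cantor_shift_iterate_in cantor_set_subset by blast+
      then show ?thesis by auto
    qed
    ultimately have bound: "3 ^ n * \<bar>x - y\<bar> \<le> 1" for n by (metis abs_mult abs_of_pos zero_less_numeral zero_less_power)
    obtain n where "1 / \<bar>x - y\<bar> < 3 ^ n" using real_arch_pow[of 3 "1 / \<bar>x - y\<bar>"] by auto
    then show False using bound[of n] ne by (simp add: field_simps)
  qed
  show "\<exists>x\<in>topspace (top_of_set cantor_set). \<forall>i<n. x \<in> D i \<longleftrightarrow> b i" for b n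
  proof -
    have "\<exists>x\<in>cantor_set. \<forall>i<n. ?T i x > 1/2 \<longleftrightarrow> b i"
    proof (induction n arbitrary: b)
      case 0
      show ?case using zero_in_cantor_set by auto
    next
      case (Suc n)
      obtain x' where x': "x' \<in> cantor_set" "\<And>i. i < n \<Longrightarrow> ?T i x' > 1/2 \<longleftrightarrow> b (Suc i)"
        using Suc[of "\<lambda>i. b (Suc i)"] by blast
      define x where "x = (if b 0 then 2 / 3 else 0) + x' / 3"
      have x'01: "0 \<le> x'" "x' \<le> 1" using x'(1) cantor_set_subset by auto
      have x: "x \<in> cantor_set" using cantor_set_third[OF x'(1)] by (simp add: x_def)
      have "cantor_shift x = x'" "x > 1/2 \<longleftrightarrow> b 0" using x'01 by (auto simp: x_def cantor_shift_def)
      then have "?T i x > 1/2 \<longleftrightarrow> b i" if "i < Suc n" for i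
        using that x'(2) by (cases i) (auto simp: funpow_swap1 simp del: funpow.simps(2) simp add: funpow_Suc_right)
      then show ?case using x by blast
    qed
    then show ?thesis by (auto simp: D_def)
  qed
qed

section \<open>The topology of the space of circular orders\<close>

lemma openin_cylinder:
  assumes "finite F" "F \<subseteq> I"
  shows "openin (product_topology (\<lambda>_. discrete_topology V) I) {x \<in> I \<rightarrow>\<^sub>E V. \<forall>t\<in>F. x t = y t}"
proof -
  have "{x \<in> I \<rightarrow>\<^sub>E V. \<forall>t\<in>F. x t = y t} = Pi\<^sub>E I (\<lambda>t. if t \<in> F then V \<inter> {y t} else V)"
    using assms(2) by (auto simp: PiE_def Pi_def split: if_splits)
  moreover have "finite {t \<in> I. (if t \<in> F then V \<inter> {y t} else V) \<noteq> V}"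
    using assms(1) by (rule rev_finite_subset) auto
  ultimately show ?thesis by (auto simp: openin_PiE_gen)
qed

text \<open>Each instance of an axiom involves finitely many values of \<open>c\<close>, so a function violating it has a whole cylinder
of violating neighbours.\<close>

lemma closedin_CO:
  fixes A :: "('a, 'b) monoid_scheme"
  assumes "group A"
  shows "closedin (product_topology (\<lambda>_. discrete_topology {1, -1, 0}) (carrier A \<times> carrier A \<times> carrier A)) (CO A)"
    (is "closedin ?P _")
proof -
  interpret group A by fact
  let ?I = "carrier A \<times> carrier A \<times> carrier A"
  have top: "topspace ?P = ?I \<rightarrow>\<^sub>E {1, -1, 0}" by simp
  have "\<exists>U. openin ?P U \<and> c \<in> U \<and> U \<subseteq> topspace ?P - CO A" if c: "c \<in> topspace ?P - CO A" for c
  proof -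
    let ?ok = "\<lambda>c w x y z g. (c (x, y, z) = 0 \<longleftrightarrow> x = y \<or> x = z \<or> y = z) \<and>
       c (x, y, z) - c (w, y, z) + c (w, x, z) - c (w, x, y) = 0 \<and>
       c (g \<otimes>\<^bsub>A\<^esub> x, g \<otimes>\<^bsub>A\<^esub> y, g \<otimes>\<^bsub>A\<^esub> z) = c (x, y, z)"
    have "\<exists>w\<in>carrier A. \<exists>x\<in>carrier A. \<exists>y\<in>carrier A. \<exists>z\<in>carrier A. \<exists>g\<in>carrier A. \<not> ?ok c w x y z g"
    proof (rule ccontr)
      assume no: "\<not> ?thesis"
      have ok: "?ok c w x y z g" if "w \<in> carrier A" "x \<in> carrier A" "y \<in> carrier A" "z \<in> carrier A" "g \<in> carrier A"
        for w x y z g using no that by blast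
      have "c \<in> ?I \<rightarrow>\<^sub>E {1, -1, 0}" using c top by blast
      note cI = this
      have "c \<in> CO A"
      proof (rule CO_I)
        show "c (x, y, z) = 1 \<or> c (x, y, z) = -1 \<or> c (x, y, z) = 0"
          if "x \<in> carrier A" "y \<in> carrier A" "z \<in> carrier A" for x y z
          using PiE_mem[OF cI, of "(x, y, z)"] that by simp
        show "(c (x, y, z) = 0) = (x = y \<or> x = z \<or> y = z)"
          if "x \<in> carrier A" "y \<in> carrier A" "z \<in> carrier A" for x y z
          using ok[OF that(1) that that(1)] by (rule conjunct1)
        show "c (x, y, z) - c (w, y, z) + c (w, x, z) - c (w, x, y) = 0"
          if "w \<in> carrier A" "x \<in> carrier A" "y \<in> carrier A" "z \<in> carrier A" for w x y z
          using ok[OF that that(1)] by (elim conjE)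
        show "c (g \<otimes>\<^bsub>A\<^esub> x, g \<otimes>\<^bsub>A\<^esub> y, g \<otimes>\<^bsub>A\<^esub> z) = c (x, y, z)"
          if "g \<in> carrier A" "x \<in> carrier A" "y \<in> carrier A" "z \<in> carrier A" for g x y z
          using ok[OF that(1,2,3,4,1)] by (elim conjE)
        show "c t = undefined" if "t \<notin> ?I" for t using PiE_arb[OF cI that] .
      qed
      then show False using c by blast
    qed
    then obtain w x y z g where v: "w \<in> carrier A" "x \<in> carrier A" "y \<in> carrier A" "z \<in> carrier A" "g \<in> carrier A"
      and bad: "\<not> ?ok c w x y z g" by blast
    let ?F = "{(x, y, z), (w, y, z), (w, x, z), (w, x, y), (g \<otimes>\<^bsub>A\<^esub> x, g \<otimes>\<^bsub>A\<^esub> y, g \<otimes>\<^bsub>A\<^esub> z)}"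
    let ?U = "{c' \<in> ?I \<rightarrow>\<^sub>E {1, -1, 0}. \<forall>t\<in>?F. c' t = c t}"
    have "openin ?P ?U" by (rule openin_cylinder) (use v in auto)
    moreover have "c \<in> ?U" using c top by blast
    moreover have "c' \<notin> CO A" if "c' \<in> ?U" for c'
    proof
      assume c': "c' \<in> CO A"
      have e: "c' (x, y, z) = c (x, y, z)" "c' (w, y, z) = c (w, y, z)" "c' (w, x, z) = c (w, x, z)"
        "c' (w, x, y) = c (w, x, y)"
        "c' (g \<otimes>\<^bsub>A\<^esub> x, g \<otimes>\<^bsub>A\<^esub> y, g \<otimes>\<^bsub>A\<^esub> z) = c (g \<otimes>\<^bsub>A\<^esub> x, g \<otimes>\<^bsub>A\<^esub> y, g \<otimes>\<^bsub>A\<^esub> z)"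
        using that by simp_all
      have "?ok c w x y z g"
        using CO_zero[OF c' v(2,3,4)] CO_cocycle[OF c' v(1,2,3,4)] CO_left[OF c' v(5,2,3,4)]
        unfolding e by (intro conjI)
      then show False using bad by (rule notE[rotated])
    qed
    ultimately show ?thesis unfolding top by blast
  qed
  then have "openin ?P (topspace ?P - CO A)" using openin_subopen[of ?P "topspace ?P - CO A"] by blast
  moreover have "CO A \<subseteq> topspace ?P" unfolding top by (auto simp: CO_def circular_order_on_def)
  ultimately show ?thesis by (simp only: closedin_def)
qed

lemma compact_space_CO_topology:
  assumes "group A" shows "compact_space (CO_topology A)"
proof -
  have "compact_space (product_topology (\<lambda>_. discrete_topology {1, -1, 0 :: int}) (carrier A \<times> carrier A \<times> carrier A))"
    by (simp add: compact_space_product_topology compact_space_discrete_topology)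
  then show ?thesis
    unfolding CO_topology_def using closedin_CO[OF assms] closedin_compact_space compact_space_subtopology by blast
qed

lemma CO_topology_nhd:
  assumes U: "openin (CO_topology A) U" "c \<in> U"
  shows "\<exists>S. finite S \<and> S \<subseteq> carrier A \<and>
    (\<forall>c'\<in>CO A. (\<forall>x\<in>S. \<forall>y\<in>S. \<forall>z\<in>S. c' (x, y, z) = c (x, y, z)) \<longrightarrow> c' \<in> U)"
proof -
  let ?I = "carrier A \<times> carrier A \<times> carrier A"
  obtain T where T: "openin (product_topology (\<lambda>_. discrete_topology {1, -1, 0}) ?I) T" "U = T \<inter> CO A"
    using U(1) by (auto simp: CO_topology_def openin_subtopology)
  have "c \<in> T" using T(2) U(2) by blast
  with T(1) have "\<exists>W. finite {t \<in> ?I. W t \<noteq> topspace (discrete_topology {1, -1, 0 :: int})} \<and>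
      (\<forall>t\<in>?I. openin (discrete_topology {1, -1, 0}) (W t)) \<and> c \<in> Pi\<^sub>E ?I W \<and> Pi\<^sub>E ?I W \<subseteq> T"
    unfolding openin_product_topology_alt by blast
  then obtain W where W: "finite {t \<in> ?I. W t \<noteq> {1, -1, 0}}" "c \<in> Pi\<^sub>E ?I W" "Pi\<^sub>E ?I W \<subseteq> T"
    unfolding topspace_discrete_topology by blast
  define F where "F = {t \<in> ?I. W t \<noteq> {1, -1, 0}}"
  define S where "S = fst ` F \<union> (fst \<circ> snd) ` F \<union> (snd \<circ> snd) ` F"
  have "finite S" using W(1) by (simp add: S_def F_def)
  moreover have "S \<subseteq> carrier A" by (auto simp: S_def F_def)
  moreover have "c' \<in> U" if c': "c' \<in> CO A" and eq: "\<forall>x\<in>S. \<forall>y\<in>S. \<forall>z\<in>S. c' (x, y, z) = c (x, y, z)" for c'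
  proof -
    have c'I: "c' \<in> ?I \<rightarrow>\<^sub>E {1, -1, 0}" using c' by (simp add: CO_def circular_order_on_def)
    have "c' \<in> Pi\<^sub>E ?I W"
    proof (rule PiE_I)
      fix t assume t: "t \<in> ?I"
      show "c' t \<in> W t"
      proof (cases "t \<in> F")
        case True
        obtain x y z where xyz: "t = (x, y, z)" by (cases t) auto
        have "x \<in> S" "y \<in> S" "z \<in> S" using True unfolding S_def xyz by force+
        then show ?thesis using eq PiE_mem[OF W(2) t] xyz by simp
      next
        case False
        then have "W t = {1, -1, 0}" using t unfolding F_def by blast
        then show ?thesis using PiE_mem[OF c'I t] by simp
      qed
    qed (use PiE_arb[OF c'I] in blast)
    then show ?thesis using W(3) T(2) c' by blast
  qed
  ultimately show ?thesis by (intro exI[of _ S] conjI ballI impI)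
qed

lemma no_isolated_point_CO_topology:
  assumes "comm_group A" "infinite (carrier A)"
  shows "\<not> isolated_point (CO_topology A) c"
proof
  assume "isolated_point (CO_topology A) c"
  then have c: "c \<in> CO A" "openin (CO_topology A) {c}"
    by (auto simp: isolated_point_def topspace_CO_topology)
  obtain S where S: "finite S" "S \<subseteq> carrier A"
    and nhd: "\<forall>c'\<in>CO A. (\<forall>x\<in>S. \<forall>y\<in>S. \<forall>z\<in>S. c' (x, y, z) = c (x, y, z)) \<longrightarrow> c' \<in> {c}"
    using CO_topology_nhd[OF c(2) singletonI] by (elim exE conjE)
  obtain c' where c': "c' \<in> CO A" "c' \<noteq> c" and eq: "\<forall>x\<in>S. \<forall>y\<in>S. \<forall>z\<in>S. c' (x, y, z) = c (x, y, z)"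
    using comm_group.exists_nearby_order[OF assms(1) c(1) assms(2) S] by (elim bexE conjE)
  have "c' \<in> {c}" by (rule mp[OF bspec[OF nhd c'(1)] eq])
  then show False using c'(2) by simp
qed

lemma clopen_coordinate_CO_topology:
  shows "openin (CO_topology A) {c \<in> CO A. c t = v}" "closedin (CO_topology A) {c \<in> CO A. c t = v}"
proof -
  have *: "openin (CO_topology A) {c \<in> CO A. c t \<in> V}" for V
  proof (cases "t \<in> carrier A \<times> carrier A \<times> carrier A")
    case True
    have "continuous_map (CO_topology A) (discrete_topology {1, -1, 0}) (\<lambda>c. c t)"
      unfolding CO_topology_def
      by (rule continuous_map_from_subtopology, rule continuous_map_product_projection[OF True])
    then have "openin (CO_topology A) {c \<in> topspace (CO_topology A). c t \<in> V \<inter> {1, -1, 0}}"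
      by (rule openin_continuous_map_preimage) simp
    moreover have "{c \<in> topspace (CO_topology A). c t \<in> V \<inter> {1, -1, 0}} = {c \<in> CO A. c t \<in> V}"
      using True CO_values[of _ A] by (cases t) (fastforce simp: topspace_CO_topology)
    ultimately show ?thesis by simp
  next
    case False
    have "c \<in> CO A \<and> c t \<in> V \<longleftrightarrow> c \<in> CO A \<and> undefined \<in> V" for c
      using CO_undefined[OF _ False, of c] by (cases "c \<in> CO A") simp_all
    then have "{c \<in> CO A. c t \<in> V} = (if undefined \<in> V then topspace (CO_topology A) else {})"
      by (simp add: topspace_CO_topology)
    then show ?thesis by simp
  qed
  show "openin (CO_topology A) {c \<in> CO A. c t = v}" using *[of "{v}"] by simp
  have "topspace (CO_topology A) - {c \<in> CO A. c t = v} = {c \<in> CO A. c t \<in> - {v}}"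
    by (auto simp: topspace_CO_topology)
  then show "closedin (CO_topology A) {c \<in> CO A. c t = v}"
    using *[of "- {v}"] by (simp add: closedin_def) (auto simp: topspace_CO_topology)
qed

lemma CO_topology_homeomorphic_bool_sequences:
  fixes A :: "('a, 'b) monoid_scheme"
  assumes A: "comm_group A" "infinite (carrier A)" "countable (carrier A)" and ne: "CO A \<noteq> {}"
  shows "CO_topology A homeomorphic_space
     product_topology (\<lambda>_::nat. discrete_topology (UNIV :: bool set)) UNIV"
proof -
  let ?I = "(carrier A \<times> carrier A \<times> carrier A) \<times> {1, -1, 0 :: int}"
  interpret comm_group A by fact
  have I: "countable ?I" "?I \<noteq> {}" using A(3) one_closed by (auto intro!: countable_SIGMA)
  define e where "e = from_nat_into ?I"
  define E where "E n = {c \<in> CO A. c (fst (e n)) = snd (e n)}" for n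
  show ?thesis
  proof (rule Cantor_space_characterization)
    show "compact_space (CO_topology A)" by (rule compact_space_CO_topology[OF is_group])
    show "topspace (CO_topology A) \<noteq> {}" using ne by (simp only: topspace_CO_topology not_False_eq_True)
    show "\<not> isolated_point (CO_topology A) c" for c by (rule no_isolated_point_CO_topology[OF A(1,2)])
    show "openin (CO_topology A) (E n)" "closedin (CO_topology A) (E n)" for n
      unfolding E_def by (rule clopen_coordinate_CO_topology)+
    show "c = c'" if c: "c \<in> topspace (CO_topology A)" "c' \<in> topspace (CO_topology A)"
      and eq: "\<And>n. c \<in> E n \<longleftrightarrow> c' \<in> E n" for c c'
    proof -
      have CO: "c \<in> CO A" "c' \<in> CO A" using c by (simp_all only: topspace_CO_topology)
      show ?thesis
      proof (rule CO_ext[OF CO])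
        fix x y z assume xyz: "x \<in> carrier A" "y \<in> carrier A" "z \<in> carrier A"
        have "((x, y, z), c (x, y, z)) \<in> ?I" using xyz CO_values[OF CO(1) xyz] by auto
        then obtain n where n: "e n = ((x, y, z), c (x, y, z))"
          unfolding e_def using from_nat_into_surj[OF I(1)] by blast
        then have "c \<in> E n" using CO(1) by (simp add: E_def)
        then have "c' \<in> E n" using eq by blast
        then show "c (x, y, z) = c' (x, y, z)" by (simp add: E_def n)
      qed
    qed
  qed
qed

theorem theoremB:
  fixes A :: "('a, 'b) monoid_scheme"
  assumes "comm_group A" and "infinite (carrier A)"
  shows "(\<nexists>c. isolated_point (CO_topology A) c) \<and>
         (countable (carrier A) \<and> CO A \<noteq> {} \<longrightarrow>
            CO_topology A homeomorphic_space top_of_set cantor_set)"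
proof (intro conjI impI)
  show "\<nexists>c. isolated_point (CO_topology A) c"
    using no_isolated_point_CO_topology[OF assms] by simp
  assume "countable (carrier A) \<and> CO A \<noteq> {}"
  then have "CO_topology A homeomorphic_space
      product_topology (\<lambda>_::nat. discrete_topology (UNIV :: bool set)) UNIV"
    by (elim conjE) (rule CO_topology_homeomorphic_bool_sequences[OF assms])
  moreover have "product_topology (\<lambda>_::nat. discrete_topology (UNIV :: bool set)) UNIV
      homeomorphic_space top_of_set cantor_set"
    by (rule homeomorphic_space_sym[THEN iffD1, OF cantor_set_homeomorphic_bool_sequences])
  ultimately show "CO_topology A homeomorphic_space top_of_set cantor_set"
    by (rule homeomorphic_space_trans)
qed

end
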